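(* Let $n,p,q\ge 1$ be integers. Let $\bm{f}\in\{0,1\}^{q\times q}$ satisfy $f_{h\ell}=0$ whenever $h\le \ell$, and let $\bm{\omega}\in\{0,1\}^{p\times q}$ have exactly one entry equal to $1$ in each row; denote by $\bm{\omega}_j\in\{0,1\}^q$ the $j$-th row of $\bm{\omega}$, written as a column vector. For $1\le h\le q$ put $d_h=\sum_{\ell=1}^q f_{h\ell}$. Let the hyperparameters $\vartheta$ consist of $\alpha_j>0$, $\beta_j>0$, $\delta_j>0$, $\nu_j\in\mathbb{R}$ for $1\le j\le p$, and, for each $h$ with $d_h>0$, a vector $\bm{\mu}_h\in\mathbb{R}^{d_h}$ and a symmetric positive definite matrix $\bm{\kappa}_h\in\mathbb{R}^{d_h\times d_h}$. Consider the Gaussian structural equation model with the prior described in the context, and let $p(X,Z\mid\vartheta,\bm{f},\bm{\omega})$ be the integrated complete-data likelihood defined there. Then for all $X=(x_{ij})\in\mathbb{R}^{n\times p}$ with rows $X_1^\top,\dots,X_n^\top$ and all $Z=(z_{ih})\in\mathbb{R}^{n\times q}$ with rows $Z_1^\top,\dots,Z_n^\top$, \begin{align*} p(X,Z \mid \vartheta,\bm{f}, \bm{\omega}) =\;&\frac{1}{\pi^{(p+q)n/2}\, 2^{qn/2}} \prod_{h=1}^q \exp \left\{ -\frac{1}{2} \sum_{i=1}^n z_{ih}^2 \right\} \left[ \frac{\det^{1/2}(\bm{\kappa}_h)}{\det^{1/2}(\tilde S_h)} \exp\left(-\frac{\tilde t_h}{2}\right) \right]^{\mathbf{1}_{\{d_h>0\}}}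 \\ &\times\prod_{j=1}^p \left[ \frac{\delta_j^{1/2}}{s_j^{1/2}}\, \frac{\Gamma(n/2+\alpha_j/2)}{\Gamma(\alpha_j/2)}\, \frac{\beta_j^{\alpha_j}} {(\beta_j^2+t_j)^{n/2+\alpha_j/2}} \right], \end{align*} where the bracket with exponent $\mathbf{1}_{\{d_h>0\}}$ is read as $1$ when $d_h=0$, and where: - $s_j=\delta_j + \bm{\omega}_j^\top \left(\sum_{i=1}^n Z_i Z_i^\top\right) \bm{\omega}_j$, $\quad a_j=s_j^{-1} \left(\sum_{i=1}^n \bm{\omega}_j^\top Z_i\, x_{ij} + \delta_j \nu_j\right)$, $\quad t_j=\sum_{i=1}^n x_{ij}^2 + \delta_j \nu_j^2 - s_j a_j^2$; - for $d_h>0$: $\tilde M_h$ is the $d_h\times d_h$ symmetric submatrix of $\sum_{i=1}^n Z_iZ_i^\top$ consisting of the rows and columns whose index $\ell$ satisfies $f_{h\ell}=1$; $\bm{\tilde m}_h\in\mathbb{R}^{d_h}$ is the subvector of $\sum_{i=1}^n z_{ih}Z_i\in\mathbb{R}^q$ consisting of the entries $\ell$ with $f_{h\ell}=1$; and $\tilde S_h = \tilde M_h + \bm{\kappa}_h$, $\quad\bm{\zeta}_h = \tilde S_h^{-1}(\bm{\tilde m}_h +\bm{\kappa}_h \bm{\mu}_h)$, $\quad\tilde t_h = \bm{\mu}_h^\top \bm{\kappa}_h \bm{\mu}_h - \bm{\zeta}_h^\top \tilde S_h \bm{\zeta}_h$.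
   Context: Notation: $\phi_d(\cdot\,;m,V)$ denotes the density of the $d$-dimensional Gaussian distribution $\mathcal{N}_d(m,V)$ with mean $m$ and covariance matrix $V$ (variance if $d=1$). $g(x;a,b)=b^a(1/x)^{a+1}\exp(-b/x)/\Gamma(a)$, $x>0$, is the inverse gamma density. $\Gamma(\cdot)$ is the Gamma function, and $\det^{1/2}(A)=\sqrt{\det A}$. Model (Gaussian SEM). The parameter is $\theta=(\Lambda,\Sigma,B)$ where: $\Lambda\in\mathbb{R}^{p\times q}$ has $\Lambda_{jh}=0$ whenever $\omega_{jh}=0$ (so each row has a single free entry); $\Sigma=\mathrm{diag}(\sigma_1^2,\dots,\sigma_p^2)$ with $\sigma_j^2>0$; $B\in\mathbb{R}^{q\times q}$ has $B_{h\ell}=0$ whenever $f_{h\ell}=0$ (so $B$ is strictly lower triangular). For $d_h>0$, $\bm{m}_h\in\mathbb{R}^{d_h}$ denotes the vector of the free entries of row $h$ of $B$, i.e. of the $B_{h\ell}$ with $f_{h\ell}=1$, in increasing order of $\ell$ (the same ordering is used for $\tilde M_h$ and $\bm{\tilde m}_h$ in the claim). Given $\theta$, the pairs $(X_i,Z_i)\in\mathbb{R}^p\times\mathbb{R}^q$, $1\le i\le n$, are independent and identically distributed with $$X_i=\Lambda Z_i+\varepsilon_i,\quad \varepsilon_i\sim\mathcal{N}_p(0,\Sigma),\qquad Z_i=(I_q-B)^{-1}\xi_i,\quad \xi_i\sim\mathcal{N}_q(0,I_q),$$ $\varepsilon_i$ and $\xi_i$ independent. Hence the complete-data likelihood is $$p(X,Z\mid\theta)=\prod_{i=1}^n\phi_p(X_i;\Lambda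 Z_i,\Sigma)\,\phi_q(Z_i;0,\Psi),\qquad \Psi=(I_q-B)^{-1}\left[(I_q-B)^{-1}\right]^\top.$$ Prior. The prior density on the free parameters is $\pi(\theta\mid\vartheta,\bm{f},\bm{\omega})=\pi(\Lambda,\Sigma\mid\vartheta,\bm{\omega})\,\pi(B\mid\vartheta,\bm{f})$ with $$\pi(\Lambda,\Sigma \mid \vartheta,\bm{\omega})=\prod_{j=1}^p\Bigg(g(\sigma_j^2; \alpha_j/2, \beta_j^2/2)\prod_{h=1}^q\left[\phi_1(\Lambda_{jh}; \nu_j, \sigma_j^2 \delta_j^{-1})\right]^{\omega_{jh}}\Bigg),\qquad \pi(B \mid \vartheta,\bm{f}) =\prod_{h:\,d_h>0}\phi_{d_h}(\bm{m}_h; \bm{\mu}_h, \bm{\kappa}_h^{-1}).$$ Integrated complete-data likelihood: $$p(X,Z\mid\vartheta,\bm{f},\bm{\omega})=\int p(X,Z\mid\theta)\,\pi(\theta\mid\vartheta,\bm{f},\bm{\omega})\,d\theta,$$ the integral being with respect to Lebesgue measure over all free parameters: $\sigma_j^2\in(0,\infty)$ for $1\le j\le p$, the $p$ free entries of $\Lambda$ in $\mathbb{R}$, and the free entries of $B$ in $\mathbb{R}$. *)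

theory Defs
  imports
    "HOL-Probability.Probability"
    "Jordan_Normal_Form.Gauss_Jordan_Elimination"
    "Jordan_Normal_Form.Determinant"
    "Jordan_Normal_Form.DL_Submatrix"
begin

unbundle no vec_syntax
unbundle no inner_syntax
hide_const (open) Finite_Cartesian_Product.vec Finite_Cartesian_Product.mat
  Finite_Cartesian_Product.row Finite_Cartesian_Product.column
  Determinants.det

text \<open>Vectors and matrices are those of \<^theory>\<open>Jordan_Normal_Form.Matrix\<close>, so that dimensions
  are ordinary natural numbers; indices start at 0.\<close>

definition inv_mat :: "real mat \<Rightarrow> real mat" where
  "inv_mat A = the (mat_inverse A)"

lemma inv_mat:
  assumes A: "A \<in> carrier_mat d d" and "det A \<noteq> 0"
  shows "inv_mat A \<in> carrier_mat d d" and "A * inv_mat A = 1\<^sub>m d" and "inv_mat A * A = 1\<^sub>m d"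
proof -
  obtain C where "mat_inverse A = Some C"
    using mat_inverse(1)[OF A, where b = "()"] det_non_zero_imp_unit[OF A assms(2), where b = "()"]
    by (cases "mat_inverse A") auto
  with mat_inverse(2)[OF A this]
  show "inv_mat A \<in> carrier_mat d d" "A * inv_mat A = 1\<^sub>m d" "inv_mat A * A = 1\<^sub>m d"
    by (simp_all add: inv_mat_def)
qed

definition sym_pos_def_mat :: "nat \<Rightarrow> real mat \<Rightarrow> bool" where
  "sym_pos_def_mat d A \<longleftrightarrow> A \<in> carrier_mat d d \<and> transpose_mat A = A \<and>
     (\<forall>v \<in> carrier_vec d. v \<noteq> 0\<^sub>v d \<longrightarrow> v \<bullet> (A *\<^sub>v v) > 0)"

text \<open>The analogue of \<^const>\<open>submatrix\<close> for vectors: \<^term>\<open>pick I k\<close> is the \<open>k\<close>-th smallest element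
  of \<open>I\<close>, so the retained entries keep their order.\<close>

definition subvector :: "'a vec \<Rightarrow> nat set \<Rightarrow> 'a vec" where
  "subvector v I = vec (card {i. i < dim_vec v \<and> i \<in> I}) (\<lambda>k. v $ pick I k)"

definition mvn_density :: "nat \<Rightarrow> real vec \<Rightarrow> real vec \<Rightarrow> real mat \<Rightarrow> real" where
  "mvn_density d x m V =
     exp (- (1/2) * ((x - m) \<bullet> (inv_mat V *\<^sub>v (x - m)))) / ((2 * pi) powr (real d / 2) * sqrt (det V))"

text \<open>In dimension 1 this is the library density.\<close>

lemma mvn_density_1:
  assumes "v > 0"
  shows "mvn_density 1 (vec 1 (\<lambda>_. x)) (vec 1 (\<lambda>_. m)) (mat 1 1 (\<lambda>_. v)) = normal_density m (sqrt v) x"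
proof -
  let ?V = "mat 1 1 (\<lambda>_. v)"
  have V: "?V \<in> carrier_mat 1 1" by simp
  have det: "det ?V = v" by (subst det_single) auto
  note inv = inv_mat[OF V, unfolded det]
  have "inv_mat ?V $$ (0, 0) = 1 / v"
  proof -
    have "(?V * inv_mat ?V) $$ (0, 0) = 1" using inv(2) assms by simp
    then show ?thesis using inv(1) assms by (auto simp: scalar_prod_def field_simps)
  qed
  with inv(1) assms
  have "(vec 1 (\<lambda>_. x) - vec 1 (\<lambda>_. m)) \<bullet> (inv_mat ?V *\<^sub>v (vec 1 (\<lambda>_. x) - vec 1 (\<lambda>_. m)))
      = (x - m)\<^sup>2 / v"
    by (simp add: scalar_prod_def power2_eq_square)
  then show ?thesis
    using assms unfolding mvn_density_def normal_density_def det
    by (simp add: powr_half_sqrt real_sqrt_mult)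
qed

definition inv_gamma_density :: "real \<Rightarrow> real \<Rightarrow> real \<Rightarrow> real" where
  "inv_gamma_density x a b = b powr a * (1 / x) powr (a + 1) * exp (- b / x) / Gamma a"

text \<open>The patterns \<open>f\<close> (of \<open>B\<close>) and \<open>\<omega>\<close> (of \<open>\<Lambda>\<close>) are matrices over \<open>nat\<close> with entries 0 and 1.\<close>

definition free_entries :: "nat mat \<Rightarrow> (nat \<times> nat) set" where
  "free_entries P = {(i, j). i < dim_row P \<and> j < dim_col P \<and> P $$ (i, j) = 1}"

text \<open>The matrix with the pattern \<open>P\<close> whose free entries are given by \<open>x\<close>.\<close>

definition fill_pattern :: "nat mat \<Rightarrow> (nat \<times> nat \<Rightarrow> real) \<Rightarrow> real mat" where
  "fill_pattern P x = mat (dim_row P) (dim_col P) (\<lambda>e. if P $$ e = 1 then x e else 0)"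

definition parents :: "nat mat \<Rightarrow> nat \<Rightarrow> nat set" where
  "parents f h = {l. l < dim_col f \<and> f $$ (h, l) = 1}"

definition indeg :: "nat mat \<Rightarrow> nat \<Rightarrow> nat" where
  "indeg f h = (\<Sum>l < dim_col f. f $$ (h, l))"

lemma indeg_eq_card_parents:
  assumes "f \<in> carrier_mat q q" "elements_mat f \<subseteq> {0, 1}" "h < q"
  shows "indeg f h = card (parents f h)"
proof -
  have "f $$ (h, l) = of_bool (l \<in> parents f h)" if "l < q" for l
  proof -
    have "f $$ (h, l) \<in> elements_mat f" using assms that by auto
    then show ?thesis using assms that by (auto simp: parents_def)
  qed
  then have "indeg f h = (\<Sum>l<q. of_bool (l \<in> parents f h))"
    using assms by (auto simp: indeg_def intro!: sum.cong)
  also have "\<dots> = card ({..<q} \<inter> parents f h)" by (simp add: Int_def)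
  also have "{..<q} \<inter> parents f h = parents f h" using assms by (auto simp: parents_def)
  finally show ?thesis .
qed

definition latent_cov :: "nat \<Rightarrow> real mat \<Rightarrow> real mat" where
  "latent_cov q B = inv_mat (1\<^sub>m q - B) * transpose_mat (inv_mat (1\<^sub>m q - B))"

definition complete_likelihood ::
  "nat \<Rightarrow> nat \<Rightarrow> nat \<Rightarrow> real mat \<Rightarrow> real mat \<Rightarrow> real mat \<Rightarrow> real mat \<Rightarrow> real mat \<Rightarrow> real" where
  "complete_likelihood n p q X Z \<Lambda> \<Sigma> B =
     (\<Prod>i<n. mvn_density p (row X i) (\<Lambda> *\<^sub>v row Z i) \<Sigma> *
             mvn_density q (row Z i) (0\<^sub>v q) (latent_cov q B))"

text \<open>\<^const>\<open>normal_density\<close> takes the standard deviation, hence the square root.\<close>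

definition prior_loadings ::
  "nat \<Rightarrow> nat \<Rightarrow> nat mat \<Rightarrow> (nat \<Rightarrow> real) \<Rightarrow> (nat \<Rightarrow> real) \<Rightarrow> (nat \<Rightarrow> real) \<Rightarrow> (nat \<Rightarrow> real) \<Rightarrow>
   real mat \<Rightarrow> real mat \<Rightarrow> real" where
  "prior_loadings p q \<omega> \<alpha> \<beta> \<delta> \<nu> \<Lambda> \<Sigma> =
     (\<Prod>j<p. inv_gamma_density (\<Sigma> $$ (j, j)) (\<alpha> j / 2) ((\<beta> j)\<^sup>2 / 2) *
        (\<Prod>h<q. normal_density (\<nu> j) (sqrt (\<Sigma> $$ (j, j) / \<delta> j)) (\<Lambda> $$ (j, h)) ^ (\<omega> $$ (j, h))))"

definition prior_coeffs ::
  "nat \<Rightarrow> nat mat \<Rightarrow> (nat \<Rightarrow> real vec) \<Rightarrow> (nat \<Rightarrow> real mat) \<Rightarrow> real mat \<Rightarrow> real" where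
  "prior_coeffs q f \<mu> \<kappa> B =
     (\<Prod>h \<in> {h. h < q \<and> indeg f h > 0}.
        mvn_density (indeg f h) (subvector (row B h) (parents f h)) (\<mu> h) (inv_mat (\<kappa> h)))"

text \<open>Lebesgue measure on the variances, the free loadings and the free coefficients.  When there
  are no free coefficients the last factor is the unit mass on a single point.\<close>

definition param_measure ::
  "nat \<Rightarrow> nat mat \<Rightarrow> nat mat \<Rightarrow>
   ((nat \<Rightarrow> real) \<times> (nat \<times> nat \<Rightarrow> real) \<times> (nat \<times> nat \<Rightarrow> real)) measure" where
  "param_measure p f \<omega> =
     (\<Pi>\<^sub>M j\<in>{..<p}. restrict_space lborel {0<..}) \<Otimes>\<^sub>M
     (\<Pi>\<^sub>M e\<in>free_entries \<omega>. lborel) \<Otimes>\<^sub>M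
     (\<Pi>\<^sub>M e\<in>free_entries f. lborel)"

text \<open>This is a Bochner integral, which is 0 for a function that is not integrable; an equation
  with a positive number therefore includes integrability.\<close>

definition integrated_likelihood ::
  "nat \<Rightarrow> nat \<Rightarrow> nat \<Rightarrow> nat mat \<Rightarrow> nat mat \<Rightarrow>
   (nat \<Rightarrow> real) \<Rightarrow> (nat \<Rightarrow> real) \<Rightarrow> (nat \<Rightarrow> real) \<Rightarrow> (nat \<Rightarrow> real) \<Rightarrow>
   (nat \<Rightarrow> real vec) \<Rightarrow> (nat \<Rightarrow> real mat) \<Rightarrow> real mat \<Rightarrow> real mat \<Rightarrow> real" where
  "integrated_likelihood n p q f \<omega> \<alpha> \<beta> \<delta> \<nu> \<mu> \<kappa> X Z =
     (\<integral>(v, x, y).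
        (let \<Lambda> = fill_pattern \<omega> x; \<Sigma> = mat_diag p v; B = fill_pattern f y in
         complete_likelihood n p q X Z \<Lambda> \<Sigma> B *
         (prior_loadings p q \<omega> \<alpha> \<beta> \<delta> \<nu> \<Lambda> \<Sigma> * prior_coeffs q f \<mu> \<kappa> B))
      \<partial>param_measure p f \<omega>)"

text \<open>The sum of the matrices \<open>Z\<^sub>i Z\<^sub>i\<^sup>T\<close> over the rows \<open>Z\<^sub>i\<close> of \<open>Z\<close>, and the sum of the vectors
  \<open>z\<^sub>i\<^sub>h Z\<^sub>i\<close>, both written entrywise.\<close>

definition gram :: "real mat \<Rightarrow> real mat" where
  "gram Z = mat (dim_col Z) (dim_col Z) (\<lambda>(k, l). \<Sum>i<dim_row Z. Z $$ (i, k) * Z $$ (i, l))"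

definition cross_vec :: "real mat \<Rightarrow> nat \<Rightarrow> real vec" where
  "cross_vec Z h = vec (dim_col Z) (\<lambda>l. \<Sum>i<dim_row Z. Z $$ (i, h) * Z $$ (i, l))"

definition omega_row :: "nat mat \<Rightarrow> nat \<Rightarrow> real vec" where
  "omega_row \<omega> j = map_vec real (row \<omega> j)"

definition s_coef :: "nat mat \<Rightarrow> (nat \<Rightarrow> real) \<Rightarrow> real mat \<Rightarrow> nat \<Rightarrow> real" where
  "s_coef \<omega> \<delta> Z j = \<delta> j + omega_row \<omega> j \<bullet> (gram Z *\<^sub>v omega_row \<omega> j)"

definition a_coef ::
  "nat mat \<Rightarrow> (nat \<Rightarrow> real) \<Rightarrow> (nat \<Rightarrow> real) \<Rightarrow> real mat \<Rightarrow> real mat \<Rightarrow> nat \<Rightarrow> real" where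
  "a_coef \<omega> \<delta> \<nu> X Z j =
     ((\<Sum>i<dim_row Z. (omega_row \<omega> j \<bullet> row Z i) * X $$ (i, j)) + \<delta> j * \<nu> j) / s_coef \<omega> \<delta> Z j"

definition t_coef ::
  "nat mat \<Rightarrow> (nat \<Rightarrow> real) \<Rightarrow> (nat \<Rightarrow> real) \<Rightarrow> real mat \<Rightarrow> real mat \<Rightarrow> nat \<Rightarrow> real" where
  "t_coef \<omega> \<delta> \<nu> X Z j =
     (\<Sum>i<dim_row X. (X $$ (i, j))\<^sup>2) + \<delta> j * (\<nu> j)\<^sup>2 - s_coef \<omega> \<delta> Z j * (a_coef \<omega> \<delta> \<nu> X Z j)\<^sup>2"

definition M_tilde :: "nat mat \<Rightarrow> real mat \<Rightarrow> nat \<Rightarrow> real mat" where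
  "M_tilde f Z h = submatrix (gram Z) (parents f h) (parents f h)"

definition m_tilde :: "nat mat \<Rightarrow> real mat \<Rightarrow> nat \<Rightarrow> real vec" where
  "m_tilde f Z h = subvector (cross_vec Z h) (parents f h)"

definition S_tilde :: "nat mat \<Rightarrow> (nat \<Rightarrow> real mat) \<Rightarrow> real mat \<Rightarrow> nat \<Rightarrow> real mat" where
  "S_tilde f \<kappa> Z h = M_tilde f Z h + \<kappa> h"

definition zeta ::
  "nat mat \<Rightarrow> (nat \<Rightarrow> real vec) \<Rightarrow> (nat \<Rightarrow> real mat) \<Rightarrow> real mat \<Rightarrow> nat \<Rightarrow> real vec" where
  "zeta f \<mu> \<kappa> Z h = inv_mat (S_tilde f \<kappa> Z h) *\<^sub>v (m_tilde f Z h + \<kappa> h *\<^sub>v \<mu> h)"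

definition t_tilde ::
  "nat mat \<Rightarrow> (nat \<Rightarrow> real vec) \<Rightarrow> (nat \<Rightarrow> real mat) \<Rightarrow> real mat \<Rightarrow> nat \<Rightarrow> real" where
  "t_tilde f \<mu> \<kappa> Z h =
     \<mu> h \<bullet> (\<kappa> h *\<^sub>v \<mu> h) - zeta f \<mu> \<kappa> Z h \<bullet> (S_tilde f \<kappa> Z h *\<^sub>v zeta f \<mu> \<kappa> Z h)"

end

theory Submission
  imports Defs
begin

text \<open>Given the rows of \<open>Z\<close>, the integrand splits into one factor for each pair of \<open>\<sigma>\<^sub>j\<^sup>2\<close> and the
  free loading of row \<open>j\<close>, and one factor for each row of \<open>B\<close>: since \<open>I - B\<close> is lower unitriangular,
  the latent precision matrix is \<open>(I - B)\<^sup>T (I - B)\<close> with determinant 1, so the latent log density is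
  a sum of squared residuals, one for each row. The factor of a loading is conjugate
  normal-inverse-gamma; the factor of a row of \<open>B\<close> is, after completing the square, a multivariate
  Gaussian, which is integrated one coordinate at a time by Schur complements. Working with
  nonnegative integrals makes Tonelli's theorem available without any integrability argument.\<close>

section \<open>Gaussian integrals\<close>

text \<open>The Gaussian integral is proved for quadratic forms whose coefficients are functions on
  the natural numbers rather than matrices: passing to a Schur complement then merely lowers the
  dimension, and the coordinates of the integration variable, which are pairs of a row and a column,
  enter through an injective labelling. Matrices are reconnected with these forms afterwards.

  The two halves of the parameter separate in different ways. Rows of B contribute blocks of
  coordinates of varying size, possibly empty, so the integral of a product over disjoint blocks is
  needed. A loading cannot be separated from its variance, because its prior variance is
  \<open>v j / \<delta> j\<close>; the loadings are therefore integrated with the variances held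
  fixed, which leaves an inverse gamma kernel in each variance. The scale of that kernel is half of
  \<beta>^2 + t, and its positivity rests on t being the minimum of a penalised sum of squares,
  hence nonnegative.\<close>

definition qform :: "nat \<Rightarrow> (nat \<Rightarrow> nat \<Rightarrow> real) \<Rightarrow> (nat \<Rightarrow> real) \<Rightarrow> real" where
  "qform d A x = (\<Sum>i<d. \<Sum>j<d. x i * A i j * x j)"

text \<open>The matrix left after one pivot step that eliminates variable \<open>d\<close>, that is,
  the Schur complement of the entry \<open>A d d\<close>.\<close>

definition schur :: "nat \<Rightarrow> (nat \<Rightarrow> nat \<Rightarrow> real) \<Rightarrow> nat \<Rightarrow> nat \<Rightarrow> real" where
  "schur d A i j = A i j - A i d * A d j / A d d"

text \<open>Completing the square in the last variable: symmetry merges the two cross terms, and the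
  Schur complement is what remains of the other block once the square has absorbed them.\<close>

lemma qform_Suc:
  assumes sym: "\<And>i j. i < Suc d \<Longrightarrow> j < Suc d \<Longrightarrow> A i j = A j i" and "A d d \<noteq> 0"
  shows "qform (Suc d) A x = A d d * (x d + (\<Sum>j<d. A d j * x j) / A d d)\<^sup>2 + qform d (schur d A) x"
proof -
  let ?b = "\<Sum>j<d. A d j * x j"
  have b: "(\<Sum>i<d. x i * A i d) = ?b"
    by (intro sum.cong) (auto simp: sym mult.commute)
  have 1: "qform (Suc d) A x = qform d A x + 2 * x d * ?b + A d d * (x d)\<^sup>2"
    unfolding qform_def
    by (simp add: sum.distrib b[symmetric] sum_distrib_left sum_distrib_right power2_eq_square
        algebra_simps sum.cong[OF refl mult.left_commute] sym)
  have "(\<Sum>i<d. \<Sum>j<d. x i * (A i d * A d j / A d d) * x j) = (\<Sum>i<d. x i * A i d) * ?b / A d d"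
    by (simp add: sum_product sum_divide_distrib mult_ac)
  then have 2: "qform d (schur d A) x = qform d A x - ?b\<^sup>2 / A d d"
    unfolding qform_def schur_def b
    by (simp add: algebra_simps sum_subtractf power2_eq_square)
  show ?thesis unfolding 1 2 using assms(2)
    by (simp add: field_simps power2_eq_square)
qed

text \<open>Block elimination factors the matrix as an upper unitriangular one times a block lower triangular
  one with diagonal blocks \<^term>\<open>schur d A\<close> and \<^term>\<open>A d d\<close>.\<close>

lemma det_schur:
  assumes "A d d \<noteq> 0"
  shows "det (mat (Suc d) (Suc d) (\<lambda>(i, j). A i j)) = A d d * det (mat d d (\<lambda>(i, j). schur d A i j))"
proof -
  let ?S = "mat d d (\<lambda>(i, j). schur d A i j)"
  let ?U = "four_block_mat (1\<^sub>m d) (mat d 1 (\<lambda>(i, j). A i d / A d d)) (0\<^sub>m 1 d) (1\<^sub>m 1)"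
  let ?L = "four_block_mat ?S (0\<^sub>m d 1) (mat 1 d (\<lambda>(i, j). A d j)) (mat 1 1 (\<lambda>_. A d d))"
  have "mat (Suc d) (Suc d) (\<lambda>(i, j). A i j) = ?U * ?L"
    by (subst mult_four_block_mat[where ?nr1.0 = d and ?n1.0 = d and ?n2.0 = 1 and ?nc1.0 = d
          and ?nc2.0 = 1 and ?nr2.0 = 1])
      (use assms in \<open>auto simp: schur_def scalar_prod_def less_Suc_eq intro!: eq_matI\<close>)
  moreover have "det ?U = 1"
    by (subst det_four_block_mat_lower_left_zero[where n=d and m=1]) auto
  moreover have "det ?L = det ?S * A d d"
    by (subst det_four_block_mat_upper_right_zero[where n=d and m=1]) (auto simp: det_single)
  moreover have "det (?U * ?L) = det ?U * det ?L"
    by (rule det_mult[where n = "Suc d"]) auto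
  ultimately show ?thesis
    by simp
qed

definition pos_def_form :: "nat \<Rightarrow> (nat \<Rightarrow> nat \<Rightarrow> real) \<Rightarrow> bool" where
  "pos_def_form d A \<longleftrightarrow> (\<forall>i<d. \<forall>j<d. A i j = A j i) \<and> (\<forall>x. (\<exists>i<d. x i \<noteq> 0) \<longrightarrow> qform d A x > 0)"

lemma pos_def_form_diag:
  assumes "pos_def_form (Suc d) A"
  shows "A d d > 0"
proof -
  have "qform (Suc d) A (\<lambda>i. of_bool (i = d)) > 0"
    using assms by (force simp: pos_def_form_def)
  then show ?thesis by (simp add: qform_def)
qed

lemma pos_def_form_schur:
  assumes "pos_def_form (Suc d) A"
  shows "pos_def_form d (schur d A)"
  unfolding pos_def_form_def
proof (intro conjI allI impI)
  note d = pos_def_form_diag[OF assms]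
  have sym: "A i j = A j i" if "i < Suc d" "j < Suc d" for i j
    using assms that by (auto simp: pos_def_form_def)
  show "schur d A i j = schur d A j i" if "i < d" "j < d" for i j
    using sym[of i j] sym[of i d] sym[of j d] that by (simp add: schur_def)
  fix x :: "nat \<Rightarrow> real" assume x: "\<exists>i<d. x i \<noteq> 0"
  \<comment> \<open>The last coordinate is chosen to make the square in \<open>qform_Suc\<close>
    vanish, so that the full form at \<open>?y\<close> equals the Schur form at
    \<open>x\<close>.\<close>
  let ?y = "x(d := - (\<Sum>j<d. A d j * x j) / A d d)"
  have y: "(\<Sum>j<d. A d j * ?y j) = (\<Sum>j<d. A d j * x j)"
    by (intro sum.cong) auto
  have "qform (Suc d) A ?y = qform d (schur d A) ?y"
    by (subst qform_Suc) (use d sym in \<open>auto simp del: fun_upd_apply simp: y\<close>, simp)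
  moreover have "qform d (schur d A) ?y = qform d (schur d A) x"
    unfolding qform_def by (intro sum.cong) auto
  moreover have "qform (Suc d) A ?y > 0"
    using assms x unfolding pos_def_form_def by (metis fun_upd_other less_SucI less_irrefl_nat)
  ultimately show "qform d (schur d A) x > 0" by simp
qed

text \<open>The determinant is the product of the pivots met in successive Schur complements, and
  each of them is positive.\<close>

lemma det_pos_def_form:
  "pos_def_form d A \<Longrightarrow> det (mat d d (\<lambda>(i, j). A i j)) > 0"
proof (induction d arbitrary: A)
  case (Suc d)
  show ?case
    using pos_def_form_diag[OF Suc.prems] Suc.IH[OF pos_def_form_schur[OF Suc.prems]]
    by (simp add: det_schur)
qed simp

text \<open>The integrand is a multiple of the normal density with mean \<open>- c\<close> and
  standard deviation \<open>1 / sqrt a\<close>, which has total mass 1.\<close>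

lemma nn_integral_gaussian:
  fixes a c :: real
  assumes "a > 0"
  shows "(\<integral>\<^sup>+x. ennreal (exp (- (1/2) * (a * (x + c)\<^sup>2))) \<partial>lborel) = ennreal (sqrt (2 * pi / a))"
proof -
  interpret prob_space "density lborel (normal_density (-c) (1 / sqrt a))"
    by (rule prob_space_normal_density) (use assms in auto)
  have 1: "(\<integral>\<^sup>+x. ennreal (normal_density (-c) (1 / sqrt a) x) \<partial>lborel) = 1"
    using emeasure_space_1 by (simp add: emeasure_density)
  have *: "exp (- (1/2) * (a * (x + c)\<^sup>2)) = sqrt (2 * pi / a) * normal_density (-c) (1 / sqrt a) x" for x
    using assms by (simp add: normal_density_def real_sqrt_divide power_divide mult_ac)
  show ?thesis
    unfolding * using assms 1 by (simp add: ennreal_mult nn_integral_cmult)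
qed

text \<open>The index set \<open>I\<close> may exceed the image of \<open>g\<close>, because the
  factor of one row of B must also be measurable on the product over all free entries.\<close>

lemma borel_measurable_qform_component:
  assumes "g ` {..<d} \<subseteq> I"
  shows "(\<lambda>x. qform d A (\<lambda>k. x (g k) - c k)) \<in> borel_measurable (\<Pi>\<^sub>M i\<in>I. lborel)"
proof -
  have [measurable]: "(\<lambda>x. x (g k)) \<in> borel_measurable (\<Pi>\<^sub>M i\<in>I. lborel)" if "k < d" for k
    using measurable_component_singleton[of "g k" I "\<lambda>_. lborel :: real measure"] assms that by auto
  show ?thesis unfolding qform_def
    by (intro borel_measurable_sum borel_measurable_times borel_measurable_diff measurable_const) auto
qed

text \<open>Induction on the dimension: integrating out coordinate \<open>g d\<close> costs
  \<open>sqrt (2 * pi / A d d)\<close> and leaves the Schur form, which is the recursion that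
  \<open>det_schur\<close> gives for the determinant. The labelling \<open>g\<close> allows
  coordinates that are not numbers.\<close>

lemma nn_integral_gaussian_form:
  assumes "pos_def_form d A" "inj_on g {..<d}"
  shows "(\<integral>\<^sup>+x. ennreal (exp (- (1/2) * qform d A (\<lambda>k. x (g k) - c k))) \<partial>(\<Pi>\<^sub>M i\<in>g ` {..<d}. lborel))
     = ennreal (sqrt ((2 * pi) ^ d / det (mat d d (\<lambda>(i, j). A i j))))"
  using assms
proof (induction d arbitrary: A)
  case 0
  interpret product_sigma_finite "\<lambda>_. lborel :: real measure" ..
  show ?case by (simp add: qform_def space_PiM)
next
  case (Suc d)
  interpret product_sigma_finite "\<lambda>_. lborel :: real measure" ..
  note pd = pos_def_form_diag[OF Suc.prems(1)]
  have sym: "A i j = A j i" if "i < Suc d" "j < Suc d" for i j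
    using Suc.prems(1) that by (auto simp: pos_def_form_def)
  have g: "g d \<notin> g ` {..<d}" and inj: "inj_on g {..<d}"
    using Suc.prems(2) by (auto simp: inj_on_def lessThan_Suc)
  have gk: "g k \<noteq> g d" if "k < d" for k using g that by (metis imageI lessThan_iff)
  let ?F = "\<lambda>x. exp (- (1/2) * qform (Suc d) A (\<lambda>k. x (g k) - c k))"
  have split: "g ` {..<Suc d} = insert (g d) (g ` {..<d})" by (auto simp: lessThan_Suc)
  have F: "?F \<in> borel_measurable (\<Pi>\<^sub>M i\<in>insert (g d) (g ` {..<d}). lborel)"
    by (intro measurable_compose[OF _ borel_measurable_exp] borel_measurable_times measurable_const
        borel_measurable_qform_component) (auto simp: less_Suc_eq)
  have "(\<integral>\<^sup>+x. ennreal (?F x) \<partial>(\<Pi>\<^sub>M i\<in>g ` {..<Suc d}. lborel))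
     = (\<integral>\<^sup>+x. \<integral>\<^sup>+y. ennreal (?F (x(g d := y))) \<partial>lborel \<partial>(\<Pi>\<^sub>M i\<in>g ` {..<d}. lborel))"
    unfolding split by (rule product_nn_integral_insert[OF _ g measurable_compose[OF F measurable_ennreal]]) simp
  also have "\<dots> = (\<integral>\<^sup>+x. ennreal (exp (- (1/2) * qform d (schur d A) (\<lambda>k. x (g k) - c k))) *
      ennreal (sqrt (2 * pi / A d d)) \<partial>(\<Pi>\<^sub>M i\<in>g ` {..<d}. lborel))"
  proof (intro nn_integral_cong)
    fix x
    \<comment> \<open>\<open>?b\<close> involves the remaining coordinates only. They merely shift
      the centre of a one-dimensional Gaussian in \<open>y\<close>, so its integral is the same for
      every \<open>x\<close>.\<close>
    let ?b = "(\<Sum>j<d. A d j * (x (g j) - c j)) / A d d"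
    have "?F (x(g d := y)) = exp (- (1/2) * qform d (schur d A) (\<lambda>k. x (g k) - c k))
        * exp (- (1/2) * (A d d * (y + (?b - c d))\<^sup>2))" for y
    proof -
      have "qform (Suc d) A (\<lambda>k. (x(g d := y)) (g k) - c k) = A d d * (y - c d + ?b)\<^sup>2 +
          qform d (schur d A) (\<lambda>k. (x(g d := y)) (g k) - c k)"
        by (subst qform_Suc) (use pd sym gk in auto)
      also have "qform d (schur d A) (\<lambda>k. (x(g d := y)) (g k) - c k) = qform d (schur d A) (\<lambda>k. x (g k) - c k)"
        unfolding qform_def by (intro sum.cong) (auto simp: gk)
      finally show ?thesis by (simp add: exp_add[symmetric] algebra_simps)
    qed
    then show "(\<integral>\<^sup>+y. ennreal (?F (x(g d := y))) \<partial>lborel) =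
       ennreal (exp (- (1/2) * qform d (schur d A) (\<lambda>k. x (g k) - c k))) * ennreal (sqrt (2 * pi / A d d))"
      by (simp only: ennreal_mult exp_ge_zero)
        (subst nn_integral_cmult, simp, subst nn_integral_gaussian[OF pd], simp)
  qed
  also have "\<dots> = ennreal (sqrt ((2 * pi) ^ d / det (mat d d (\<lambda>(i, j). schur d A i j)))) * ennreal (sqrt (2 * pi / A d d))"
  proof (subst nn_integral_multc)
    show "(\<lambda>x. ennreal (exp (- (1/2) * qform d (schur d A) (\<lambda>k. x (g k) - c k))))
        \<in> borel_measurable (\<Pi>\<^sub>M i\<in>g ` {..<d}. lborel)"
      by (intro measurable_compose[OF _ measurable_ennreal] measurable_compose[OF _ borel_measurable_exp]
        borel_measurable_times borel_measurable_const borel_measurable_qform_component order_refl)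
  qed (simp only: Suc.IH[OF pos_def_form_schur[OF Suc.prems(1)] inj])
  also have "\<dots> = ennreal (sqrt ((2 * pi) ^ Suc d / det (mat (Suc d) (Suc d) (\<lambda>(i, j). A i j))))"
    using pd by (simp add: det_schur ennreal_mult'[symmetric] real_sqrt_mult[symmetric] mult_ac)
  finally show ?case .
qed

section \<open>Inverse gamma integral and Tonelli for disjoint blocks\<close>

text \<open>The substitution \<open>t = b / x\<close> turns this into the integral that defines the
  Gamma function.\<close>

lemma nn_integral_inverse_gamma:
  assumes "(a::real) > 0" "b > 0"
  shows "(\<integral>\<^sup>+x. ennreal ((1 / x) powr (a + 1) * exp (- b / x)) * indicator {0<..} x \<partial>lborel)
     = ennreal (Gamma a / b powr a)"
proof -
  let ?f = "\<lambda>t. t powr (a - 1) * exp (- t)"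
  let ?g = "\<lambda>x. b / x" let ?g' = "\<lambda>x. - b / x\<^sup>2"
  let ?h = "\<lambda>x. (1 / x) powr (a + 1) * exp (- b / x)"
  have img: "?g ` {0<..} = {0<..}"
  proof -
    have "y \<in> ?g ` {0<..}" if "y > 0" for y
      using that assms by (intro image_eqI[of _ _ "b / y"]) auto
    then show ?thesis using assms by auto
  qed
  \<comment> \<open>The Gamma integral is given on the closed half line, whereas
    \<open>b / x\<close> is a bijection of the open one; the two differ by the null set {0}.\<close>
  have G: "(?f has_integral Gamma a) {0<..}"
  proof -
    have "((\<lambda>t. if t \<in> {0<..} then t powr (a - 1) / exp t else 0) has_integral Gamma a) {0..}"
      by (rule has_integral_spike[OF _ _ Gamma_integral_real[OF assms(1)], of "{0}"]) auto
    then have "((\<lambda>t. t powr (a - 1) / exp t) has_integral Gamma a) {0<..}"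
      by (subst (asm) has_integral_restrict) auto
    then show ?thesis by (simp add: exp_minus field_simps)
  qed
  \<comment> \<open>The change of variables is about absolute integrability, which a nonnegative
    function gets from the existence of its integral.\<close>
  have "?f absolutely_integrable_on {0<..}"
    by (rule nonnegative_absolutely_integrable_1) (use G in \<open>auto simp: integrable_on_def\<close>)
  then have "?f absolutely_integrable_on (?g ` {0<..}) \<and> integral (?g ` {0<..}) ?f = Gamma a"
    unfolding img using G by (auto simp: integral_unique)
  then have "(\<lambda>x. \<bar>?g' x\<bar> * ?f (?g x)) absolutely_integrable_on {0<..} \<and>
     integral {0<..} (\<lambda>x. \<bar>?g' x\<bar> * ?f (?g x)) = Gamma a"
    by (subst has_absolute_integral_change_of_variables_1')
      (use assms in \<open>auto intro!: derivative_eq_intros inj_onI simp: field_simps power2_eq_square\<close>)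
  then have "((\<lambda>x. \<bar>?g' x\<bar> * ?f (?g x)) has_integral Gamma a) {0<..}"
    using has_integral_integrable_integral absolutely_integrable_on_def by blast
  \<comment> \<open>The Jacobian \<open>b / x\<^sup>2\<close> raises the exponent of
    \<open>1 / x\<close> from \<open>a - 1\<close> to \<open>a + 1\<close> and that of
    \<open>b\<close> from \<open>a - 1\<close> to \<open>a\<close>.\<close>
  moreover have "\<bar>?g' x\<bar> * ?f (?g x) = b powr a * ?h x" if "x \<in> {0<..}" for x
  proof -
    have "(b / x) powr (a - 1) = b powr (a - 1) * (1 / x) powr (a - 1)"
      using powr_mult[of b "1 / x" "a - 1"] that assms by simp
    moreover have "(1 / x) powr (a + 1) = (1 / x) powr (a - 1) * (1 / x)\<^sup>2"
      using powr_add[of "1 / x" "a - 1" 2] that by (simp add: add.commute)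
    moreover have "b powr a = b powr (a - 1) * b"
      using powr_add[of b "a - 1" 1] assms by simp
    moreover have "\<bar>?g' x\<bar> = b * (1 / x)\<^sup>2"
      using assms by (simp add: power_one_over)
    ultimately show ?thesis by simp
  qed
  ultimately have "((\<lambda>x. b powr a * ?h x) has_integral Gamma a) {0<..}"
    by (rule has_integral_eq[rotated])
  from has_integral_mult_right[OF this, of "1 / b powr a"]
  have "(?h has_integral (Gamma a / b powr a)) {0<..}"
    using assms by simp
  then have "(\<integral>\<^sup>+x. ennreal (indicator {0<..} x * ?h x) \<partial>lborel) = ennreal (Gamma a / b powr a)"
    by (intro nn_integral_has_integral_lebesgue) auto
  also have "(\<integral>\<^sup>+x. ennreal (indicator {0<..} x * ?h x) \<partial>lborel)
     = (\<integral>\<^sup>+x. ennreal (?h x) * indicator {0<..} x \<partial>lborel)"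
    by (intro nn_integral_cong) (auto simp: indicator_def)
  finally show ?thesis .
qed

text \<open>Each factor owns a block of coordinates instead of a single one. The induction splits
  off the block \<open>I k\<close>; the last assumption says that a factor sees only its own block,
  so a merged argument can be replaced by the part that matters.\<close>

lemma (in product_sigma_finite) nn_integral_prod_disjoint:
  assumes "finite H" "\<And>h. h \<in> H \<Longrightarrow> finite (I h)" "disjoint_family_on I H"
    and "\<And>h. h \<in> H \<Longrightarrow> F h \<in> borel_measurable (Pi\<^sub>M (I h) M)"
    and "\<And>h x y. h \<in> H \<Longrightarrow> (\<And>i. i \<in> I h \<Longrightarrow> x i = y i) \<Longrightarrow> F h x = F h y"
  shows "(\<integral>\<^sup>+x. (\<Prod>h\<in>H. F h x) \<partial>Pi\<^sub>M (\<Union>h\<in>H. I h) M) = (\<Prod>h\<in>H. integral\<^sup>N (Pi\<^sub>M (I h) M) (F h))"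
  using assms
proof (induction H)
  case empty
  show ?case by (simp add: space_PiM)
next
  case (insert k H)
  let ?J = "\<Union>h\<in>H. I h"
  have F_cong: "F h (restrict x (I h)) = F h x" if "h \<in> insert k H" for h x
    by (rule insert.prems(4)[OF that]) simp
  \<comment> \<open>A function of the block \<open>I h\<close> factors through the restriction to
    \<open>I h\<close> and is therefore measurable on every larger product.\<close>
  have meas: "F h \<in> borel_measurable (Pi\<^sub>M J M)" if "h \<in> insert k H" "I h \<subseteq> J" for h J
  proof -
    have "(\<lambda>x. F h (restrict x (I h))) \<in> borel_measurable (Pi\<^sub>M J M)"
      by (rule measurable_compose[OF measurable_restrict_subset[OF that(2)] insert.prems(3)[OF that(1)]])
    then show ?thesis by (simp add: F_cong[OF that(1)])
  qed
  have disj: "I k \<inter> ?J = {}"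
    using insert.prems(2) insert.hyps(2) by (auto simp: disjoint_family_on_def)
  have fin: "finite (I k)" "finite ?J" using insert.prems(1) insert.hyps(1) by auto
  have Un: "(\<Union>h\<in>insert k H. I h) = I k \<union> ?J" by simp
  have mm: "(\<lambda>x. \<Prod>h\<in>insert k H. F h x) \<in> borel_measurable (Pi\<^sub>M (I k \<union> ?J) M)"
    by (intro borel_measurable_prod_ennreal meas) auto
  have mJ: "(\<lambda>x. \<Prod>h\<in>H. F h x) \<in> borel_measurable (Pi\<^sub>M ?J M)"
    by (intro borel_measurable_prod_ennreal meas) auto
  have "(\<integral>\<^sup>+x. (\<Prod>h\<in>insert k H. F h x) \<partial>Pi\<^sub>M (\<Union>h\<in>insert k H. I h) M)
     = (\<integral>\<^sup>+x. \<integral>\<^sup>+y. (\<Prod>h\<in>insert k H. F h (merge (I k) ?J (x, y))) \<partial>Pi\<^sub>M ?J M \<partial>Pi\<^sub>M (I k) M)"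
    unfolding Un by (rule product_nn_integral_fold[OF disj fin mm])
  also have "\<dots> = (\<integral>\<^sup>+x. \<integral>\<^sup>+y. F k x * (\<Prod>h\<in>H. F h y) \<partial>Pi\<^sub>M ?J M \<partial>Pi\<^sub>M (I k) M)"
  proof (intro nn_integral_cong)
    fix x y
    have "F k (merge (I k) ?J (x, y)) = F k x"
      by (rule insert.prems(4)) (simp_all add: merge_def)
    moreover have "F h (merge (I k) ?J (x, y)) = F h y" if "h \<in> H" for h
    proof (rule insert.prems(4))
      show "merge (I k) ?J (x, y) i = y i" if "i \<in> I h" for i
        using \<open>h \<in> H\<close> that disj by (auto simp: merge_def)
    qed (use that in simp)
    ultimately show "(\<Prod>h\<in>insert k H. F h (merge (I k) ?J (x, y))) = F k x * (\<Prod>h\<in>H. F h y)"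
      using insert.hyps by simp
  qed
  also have "\<dots> = integral\<^sup>N (Pi\<^sub>M (I k) M) (F k) * (\<integral>\<^sup>+y. (\<Prod>h\<in>H. F h y) \<partial>Pi\<^sub>M ?J M)"
    by (simp add: nn_integral_cmult[OF mJ] nn_integral_multc insert.prems(3))
  also have "(\<integral>\<^sup>+y. (\<Prod>h\<in>H. F h y) \<partial>Pi\<^sub>M ?J M) = (\<Prod>h\<in>H. integral\<^sup>N (Pi\<^sub>M (I h) M) (F h))"
  proof (rule insert.IH)
    show "disjoint_family_on I H" using insert.prems(2) by (auto simp: disjoint_family_on_def)
    show "F h x = F h y" if "h \<in> H" "\<And>i. i \<in> I h \<Longrightarrow> x i = y i" for h x y
      by (rule insert.prems(4)) (use that in blast)+
  qed (use insert.prems(1,3) in blast)+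
  finally show ?case using insert.hyps by simp
qed

text \<open>\<open>G\<close> stays a joint function of \<open>v\<close> and \<open>x\<close>,
  because a variance sets the scale of its loading; \<open>H\<close> involves the last variable only
  and comes out as a constant.\<close>

lemma nn_integral_triple_product:
  assumes "sigma_finite_measure M2" "sigma_finite_measure M3"
    and [measurable]: "(\<lambda>(v, x). G v x) \<in> borel_measurable (M1 \<Otimes>\<^sub>M M2)" "H \<in> borel_measurable M3"
  shows "(\<integral>\<^sup>+(v, x, y). G v x * H y \<partial>(M1 \<Otimes>\<^sub>M M2 \<Otimes>\<^sub>M M3))
     = (\<integral>\<^sup>+v. \<integral>\<^sup>+x. G v x \<partial>M2 \<partial>M1) * integral\<^sup>N M3 H"
proof -
  interpret M2: sigma_finite_measure M2 by fact
  interpret M3: sigma_finite_measure M3 by fact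
  interpret P: sigma_finite_measure "M2 \<Otimes>\<^sub>M M3"
    by (intro sigma_finite_pair_measure assms)
  have [measurable]: "(\<lambda>x. G (fst x) (fst (snd x))) \<in> borel_measurable (M1 \<Otimes>\<^sub>M M2 \<Otimes>\<^sub>M M3)"
    using measurable_compose[OF _ assms(3), of "\<lambda>x. (fst x, fst (snd x))" "M1 \<Otimes>\<^sub>M M2 \<Otimes>\<^sub>M M3"]
    by simp
  have "(\<integral>\<^sup>+(v, x, y). G v x * H y \<partial>(M1 \<Otimes>\<^sub>M M2 \<Otimes>\<^sub>M M3))
     = (\<integral>\<^sup>+v. \<integral>\<^sup>+(x, y). G v x * H y \<partial>(M2 \<Otimes>\<^sub>M M3) \<partial>M1)"
    using P.nn_integral_fst[of "\<lambda>(v, x, y). G v x * H y" M1] by (simp add: split_beta')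
  also have "\<dots> = (\<integral>\<^sup>+v. \<integral>\<^sup>+x. G v x * integral\<^sup>N M3 H \<partial>M2 \<partial>M1)"
  proof (intro nn_integral_cong)
    fix v assume "v \<in> space M1"
    then have [measurable]: "G v \<in> borel_measurable M2"
      using measurable_Pair2[OF assms(3)] by simp
    show "(\<integral>\<^sup>+(x, y). G v x * H y \<partial>(M2 \<Otimes>\<^sub>M M3)) = (\<integral>\<^sup>+x. G v x * integral\<^sup>N M3 H \<partial>M2)"
      using M3.nn_integral_fst[of "\<lambda>(x, y). G v x * H y" M2]
      by (simp add: split_beta' nn_integral_cmult)
  qed
  also have "\<dots> = (\<integral>\<^sup>+v. (\<integral>\<^sup>+x. G v x \<partial>M2) * integral\<^sup>N M3 H \<partial>M1)"
  proof (intro nn_integral_cong)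
    fix v assume "v \<in> space M1"
    then have [measurable]: "G v \<in> borel_measurable M2"
      using measurable_Pair2[OF assms(3)] by simp
    show "(\<integral>\<^sup>+x. G v x * integral\<^sup>N M3 H \<partial>M2) = (\<integral>\<^sup>+x. G v x \<partial>M2) * integral\<^sup>N M3 H"
      by (rule nn_integral_multc) auto
  qed
  also have "\<dots> = (\<integral>\<^sup>+v. \<integral>\<^sup>+x. G v x \<partial>M2 \<partial>M1) * integral\<^sup>N M3 H"
    using M2.borel_measurable_nn_integral_fst[OF assms(3)] by (intro nn_integral_multc) simp
  finally show ?thesis .
qed

section \<open>Multivariate normal densities\<close>

lemma scalar_prod_mult_mat_vec_eq_qform:
  assumes "A \<in> carrier_mat d d" "v \<in> carrier_vec d"
  shows "v \<bullet> (A *\<^sub>v v) = qform d (\<lambda>i j. A $$ (i, j)) (\<lambda>i. v $ i)"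
  using assms by (auto simp: qform_def scalar_prod_def sum_distrib_left lessThan_atLeast0 mult_ac)

lemma sym_mat_index:
  assumes "transpose_mat A = A" "A \<in> carrier_mat d d" "i < d" "j < d"
  shows "A $$ (i, j) = A $$ (j, i)"
  using assms by (metis carrier_matD index_transpose_mat(1))

lemma pos_def_form_of_mat:
  assumes "sym_pos_def_mat d A"
  shows "pos_def_form d (\<lambda>i j. A $$ (i, j))"
  unfolding pos_def_form_def
proof (intro conjI allI impI)
  have A: "A \<in> carrier_mat d d" "transpose_mat A = A"
    using assms by (auto simp: sym_pos_def_mat_def)
  show "A $$ (i, j) = A $$ (j, i)" if "i < d" "j < d" for i j
    using sym_mat_index A that by blast
  fix x :: "nat \<Rightarrow> real" assume x: "\<exists>i<d. x i \<noteq> 0"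
  then have "vec d x \<noteq> 0\<^sub>v d" by (metis index_vec index_zero_vec(1))
  then have "vec d x \<bullet> (A *\<^sub>v vec d x) > 0"
    using assms by (auto simp: sym_pos_def_mat_def)
  then have "qform d (\<lambda>i j. A $$ (i, j)) (\<lambda>i. vec d x $ i) > 0"
    by (simp add: scalar_prod_mult_mat_vec_eq_qform[OF A(1)])
  then show "qform d (\<lambda>i j. A $$ (i, j)) x > 0" by (simp add: qform_def)
qed

lemma det_sym_pos_def_mat:
  assumes "sym_pos_def_mat d A"
  shows "det A > 0"
proof -
  have "mat d d (\<lambda>(i, j). A $$ (i, j)) = A"
    using assms by (intro eq_matI) (auto simp: sym_pos_def_mat_def)
  then show ?thesis using det_pos_def_form[OF pos_def_form_of_mat[OF assms]] by simp
qed

lemma nn_integral_gaussian_mat: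
  assumes "sym_pos_def_mat d A" "inj_on g {..<d}" "c \<in> carrier_vec d"
  shows "(\<integral>\<^sup>+x. ennreal (exp (- (1/2) * ((vec d (\<lambda>k. x (g k)) - c) \<bullet> (A *\<^sub>v (vec d (\<lambda>k. x (g k)) - c)))))
            \<partial>(\<Pi>\<^sub>M i\<in>g ` {..<d}. lborel))
     = ennreal (sqrt ((2 * pi) ^ d / det A))"
proof -
  have A: "A \<in> carrier_mat d d" using assms by (auto simp: sym_pos_def_mat_def)
  have "mat d d (\<lambda>(i, j). A $$ (i, j)) = A"
    using A by (intro eq_matI) auto
  moreover have "(vec d (\<lambda>k. x (g k)) - c) \<bullet> (A *\<^sub>v (vec d (\<lambda>k. x (g k)) - c))
      = qform d (\<lambda>i j. A $$ (i, j)) (\<lambda>k. x (g k) - c $ k)" for x :: "'a \<Rightarrow> real"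
    using assms(3) by (subst scalar_prod_mult_mat_vec_eq_qform[OF A]) (auto simp: qform_def)
  ultimately show ?thesis
    using nn_integral_gaussian_form[OF pos_def_form_of_mat[OF assms(1)] assms(2), of "\<lambda>k. c $ k"] by simp
qed

text \<open>A one-sided inverse of a square matrix suffices: multiplicativity of the determinant
  makes \<open>A\<close> invertible, and the right inverse then agrees with the inverse.\<close>

lemma inv_mat_unique:
  assumes A: "A \<in> carrier_mat d d" and C: "C \<in> carrier_mat d d" and "A * C = 1\<^sub>m d"
  shows "inv_mat A = C"
proof -
  have "det A * det C = 1" using det_mult[OF A C] assms(3) by simp
  then have "det A \<noteq> 0" by auto
  note inv = inv_mat[OF A this]
  have "inv_mat A = inv_mat A * (A * C)" using inv(1) assms(3) by simp
  also have "\<dots> = C" using inv A C by (simp add: assoc_mult_mat[symmetric])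
  finally show ?thesis .
qed

lemma det_mat_diag: "det (mat_diag d v :: real mat) = (\<Prod>j<d. v j)"
  by (subst det_upper_triangular[of _ d])
    (auto simp: mat_diag_def prod_list_diag_prod atLeast0LessThan intro!: upper_triangularI)

text \<open>A diagonal covariance makes the coordinates independent. This is what splits the density
  of one observation over the rows of the loading matrix.\<close>

lemma mvn_density_diag:
  assumes "x \<in> carrier_vec d" "m \<in> carrier_vec d" "\<And>j. j < d \<Longrightarrow> v j > 0"
  shows "mvn_density d x m (mat_diag d v) = (\<Prod>j<d. normal_density (m $ j) (sqrt (v j)) (x $ j))"
proof -
  have "mat_diag d (\<lambda>j. v j * (1 / v j)) = 1\<^sub>m d"
    using less_imp_neq[OF assms(3)] by (intro eq_matI) (auto simp: mat_diag_def)
  then have inv: "inv_mat (mat_diag d v) = mat_diag d (\<lambda>j. 1 / v j)"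
    by (intro inv_mat_unique[of _ d]) auto
  have quad: "(x - m) \<bullet> (mat_diag d (\<lambda>j. 1 / v j) *\<^sub>v (x - m)) = (\<Sum>j<d. (x $ j - m $ j)\<^sup>2 / v j)"
    using assms(1,2)
    by (auto simp: scalar_prod_def mat_diag_def if_distrib[of "\<lambda>z. z * _"] sum.delta' atLeast0LessThan
        power2_eq_square cong: if_cong intro!: sum.cong)
  have sqrt: "(\<Prod>j<k. sqrt (v j)) = sqrt (\<Prod>j<k. v j)" for k
    by (induction k) (auto simp: real_sqrt_mult)
  have "(\<Prod>j<d. normal_density (m $ j) (sqrt (v j)) (x $ j))
     = (\<Prod>j<d. exp (- (x $ j - m $ j)\<^sup>2 / (2 * v j)) / (sqrt (2 * pi) * sqrt (v j)))"
    using assms(3) by (intro prod.cong) (auto simp: normal_density_def real_sqrt_mult less_imp_le)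
  also have "\<dots> = exp (\<Sum>j<d. - (x $ j - m $ j)\<^sup>2 / (2 * v j)) / (sqrt (2 * pi) ^ d * sqrt (\<Prod>j<d. v j))"
    by (simp add: prod_dividef exp_sum prod.distrib sqrt)
  also have "sqrt (2 * pi) ^ d = (2 * pi) powr (real d / 2)"
    by (simp add: powr_half_sqrt[symmetric] powr_realpow[symmetric] powr_powr)
  finally show ?thesis
    unfolding mvn_density_def inv quad det_mat_diag
    by (simp add: sum_negf sum_divide_distrib sum_distrib_left mult.commute)
qed

lemma mvn_density_latent_cov:
  assumes B: "B \<in> carrier_mat q q" and tri: "\<And>h l. h < q \<Longrightarrow> l < q \<Longrightarrow> h \<le> l \<Longrightarrow> B $$ (h, l) = 0"
    and z: "z \<in> carrier_vec q"
  shows "mvn_density q z (0\<^sub>v q) (latent_cov q B)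
     = exp (- (1/2) * (\<Sum>h<q. (z $ h - (\<Sum>l<q. B $$ (h, l) * z $ l))\<^sup>2)) / (2 * pi) powr (real q / 2)"
proof -
  let ?T = "1\<^sub>m q - B"
  let ?C = "inv_mat ?T"
  have T: "?T \<in> carrier_mat q q" using B by auto
  have Tt: "transpose_mat ?T \<in> carrier_mat q q" using T by auto
  \<comment> \<open>\<open>tri\<close> includes the case \<open>h = l\<close>, so every diagonal
    entry of \<open>?T\<close> is 1.\<close>
  have "det ?T = 1"
    using B by (subst det_lower_triangular[of q])
      (auto simp: tri prod_list_diag_prod intro!: prod.neutral)
  note C = inv_mat[OF T, unfolded this, simplified]
  have Ct: "transpose_mat ?C \<in> carrier_mat q q" using C by auto
  have CT: "transpose_mat ?C * transpose_mat ?T = 1\<^sub>m q"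
    using C(2) transpose_mult[OF T C(1)] by simp
  have "det ?C = 1"
    using det_mult[OF T C(1)] C(2) \<open>det ?T = 1\<close> by simp
  then have det: "det (latent_cov q B) = 1"
    using det_mult[OF C(1) Ct] det_transpose[OF C(1)] by (simp add: latent_cov_def)
  \<comment> \<open>The candidate inverse is checked by multiplication from the right: the two
    transposes cancel in the middle, and \<open>?C * ?T\<close> remains.\<close>
  have "latent_cov q B * (transpose_mat ?T * ?T) = ?C * (transpose_mat ?C * (transpose_mat ?T * ?T))"
    unfolding latent_cov_def by (rule assoc_mult_mat[OF C(1) Ct mult_carrier_mat[OF Tt T]])
  also have "transpose_mat ?C * (transpose_mat ?T * ?T) = ?T"
    using assoc_mult_mat[OF Ct Tt T] left_mult_one_mat[OF T] unfolding CT by simp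
  finally have inv: "inv_mat (latent_cov q B) = transpose_mat ?T * ?T"
    using C mult_carrier_mat[OF Tt T] mult_carrier_mat[OF C(1) Ct]
    by (intro inv_mat_unique[of _ q]) (simp_all add: latent_cov_def)
  have Tz: "?T *\<^sub>v z \<in> carrier_vec q" using T z by auto
  have Tz_eq: "?T *\<^sub>v z = z - B *\<^sub>v z"
    using B z by (simp add: minus_mult_distrib_mat_vec[of _ q q])
  have "z \<bullet> ((transpose_mat ?T * ?T) *\<^sub>v z) = (transpose_mat ?T *\<^sub>v (?T *\<^sub>v z)) \<bullet> z"
    using T Tt z Tz
    by (simp add: assoc_mult_mat_vec[of _ q q _ q] comm_scalar_prod[of z q "transpose_mat ?T *\<^sub>v (?T *\<^sub>v z)"])
  also have "\<dots> = (?T *\<^sub>v z) \<bullet> (?T *\<^sub>v z)"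
    by (rule transpose_vec_mult_scalar[OF T z Tz])
  also have "\<dots> = (\<Sum>h<q. (z $ h - (\<Sum>l<q. B $$ (h, l) * z $ l))\<^sup>2)"
    unfolding Tz_eq using B z by (auto simp: scalar_prod_def atLeast0LessThan power2_eq_square)
  finally have quad: "z \<bullet> ((transpose_mat ?T * ?T) *\<^sub>v z) = (\<Sum>h<q. (z $ h - (\<Sum>l<q. B $$ (h, l) * z $ l))\<^sup>2)" .
  show ?thesis
    using z unfolding mvn_density_def inv det by (simp add: quad)
qed

text \<open>The prior on a row is parametrised by its precision. Inverting the covariance
  \<open>inv_mat K\<close> gives \<open>K\<close> back, and the reciprocal determinant moves to the
  numerator.\<close>

lemma mvn_density_precision:
  assumes "sym_pos_def_mat d K"
  shows "mvn_density d x m (inv_mat K)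
     = sqrt (det K) / (2 * pi) powr (real d / 2) * exp (- (1/2) * ((x - m) \<bullet> (K *\<^sub>v (x - m))))"
proof -
  have K: "K \<in> carrier_mat d d" using assms by (auto simp: sym_pos_def_mat_def)
  have "det K > 0" by (rule det_sym_pos_def_mat[OF assms])
  note C = inv_mat[OF K, OF less_imp_neq[OF this, symmetric]]
  have "det K * det (inv_mat K) = 1"
    using det_mult[OF K C(1)] C(2) by simp
  then have det: "det (inv_mat K) = 1 / det K" using \<open>det K > 0\<close> by (simp add: field_simps)
  show ?thesis
    unfolding mvn_density_def inv_mat_unique[OF C(1) K C(3)] det
    by (simp add: real_sqrt_divide)
qed

lemma quadratic_minus:
  fixes A :: "real mat"
  assumes A: "A \<in> carrier_mat d d" "transpose_mat A = A" and x: "x \<in> carrier_vec d" and y: "y \<in> carrier_vec d"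
  shows "(x - y) \<bullet> (A *\<^sub>v (x - y)) = x \<bullet> (A *\<^sub>v x) - 2 * (x \<bullet> (A *\<^sub>v y)) + y \<bullet> (A *\<^sub>v y)"
proof -
  have Ax: "A *\<^sub>v x \<in> carrier_vec d" and Ay: "A *\<^sub>v y \<in> carrier_vec d" using A x y by auto
  have "y \<bullet> (A *\<^sub>v x) = x \<bullet> (A *\<^sub>v y)"
    using transpose_vec_mult_scalar[OF A(1) x y] A(2) comm_scalar_prod[OF x Ay] by simp
  then show ?thesis
    using x y Ax Ay A by (simp add: mult_minus_distrib_mat_vec[of _ d d] minus_scalar_prod_distrib[of _ d]
        scalar_prod_minus_distrib[of _ d])
qed

text \<open>\<open>z\<close> is the point where the gradient of the left side vanishes, since
  \<open>M + K\<close> maps it to \<open>m + K *\<^sub>v \<mu>\<close>; the linear terms then agree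
  and only a constant is left. In the application \<open>M\<close> and \<open>m\<close> come from
  the data, \<open>K\<close> and \<open>\<mu>\<close> from the prior.\<close>

lemma complete_the_square:
  fixes M K :: "real mat"
  assumes M: "M \<in> carrier_mat d d" "transpose_mat M = M"
    and K: "K \<in> carrier_mat d d" "transpose_mat K = K"
    and det: "det (M + K) \<noteq> 0"
    and x: "x \<in> carrier_vec d" and m: "m \<in> carrier_vec d" and \<mu>: "\<mu> \<in> carrier_vec d"
  defines "z \<equiv> inv_mat (M + K) *\<^sub>v (m + K *\<^sub>v \<mu>)"
  shows "x \<bullet> (M *\<^sub>v x) - 2 * (x \<bullet> m) + (x - \<mu>) \<bullet> (K *\<^sub>v (x - \<mu>))
     = (x - z) \<bullet> ((M + K) *\<^sub>v (x - z)) + (\<mu> \<bullet> (K *\<^sub>v \<mu>) - z \<bullet> ((M + K) *\<^sub>v z))"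
proof -
  have S: "M + K \<in> carrier_mat d d" "transpose_mat (M + K) = M + K"
    using M K by (auto simp: transpose_add)
  note I = inv_mat[OF S(1) det]
  have b: "m + K *\<^sub>v \<mu> \<in> carrier_vec d" "K *\<^sub>v \<mu> \<in> carrier_vec d" using m K \<mu> by auto
  have z: "z \<in> carrier_vec d" unfolding z_def using I b by auto
  have Sz: "(M + K) *\<^sub>v z = m + K *\<^sub>v \<mu>"
    unfolding z_def using assoc_mult_mat_vec[OF S(1) I(1) b(1)] I(2) b(1) by simp
  have xS: "x \<bullet> ((M + K) *\<^sub>v x) = x \<bullet> (M *\<^sub>v x) + x \<bullet> (K *\<^sub>v x)"
    using M K x by (simp add: add_mult_distrib_mat_vec[of _ d d] scalar_prod_add_distrib[of _ d])
  show ?thesis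
    unfolding quadratic_minus[OF S x z] quadratic_minus[OF K x \<mu>] xS Sz
    using x m b by (simp add: scalar_prod_add_distrib[of _ d])
qed

section \<open>Conjugate normal regression\<close>

text \<open>Regression through the origin with slope \<open>l\<close>, error variance
  \<open>v\<close> and a Gaussian prior on the slope: \<open>s / v\<close> is the posterior
  precision of the slope, \<open>a\<close> its posterior mean, and \<open>t\<close> the minimum over
  \<open>l\<close> of the penalised sum of squares.\<close>

lemma nn_integral_regression:
  fixes x z :: "nat \<Rightarrow> real" and v \<delta> \<nu> :: real and n :: nat
  assumes "v > 0" "\<delta> > 0"
  defines "s \<equiv> \<delta> + (\<Sum>i<n. (z i)\<^sup>2)"
  defines "a \<equiv> ((\<Sum>i<n. z i * x i) + \<delta> * \<nu>) / s"
  defines "t \<equiv> (\<Sum>i<n. (x i)\<^sup>2) + \<delta> * \<nu>\<^sup>2 - s * a\<^sup>2"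
  shows "(\<integral>\<^sup>+l. ennreal ((\<Prod>i<n. normal_density (l * z i) (sqrt v) (x i)) * normal_density \<nu> (sqrt (v / \<delta>)) l) \<partial>lborel)
     = ennreal ((2 * pi * v) powr (- real n / 2) * sqrt (\<delta> / s) * exp (- t / (2 * v)))"
proof -
  have s: "s > 0" unfolding s_def using assms(2) by (intro add_pos_nonneg sum_nonneg) auto
  \<comment> \<open>With the two sums eliminated in favour of \<open>s\<close> and \<open>a\<close>,
    completing the square becomes a polynomial identity.\<close>
  have zx: "(\<Sum>i<n. z i * x i) = s * a - \<delta> * \<nu>" using s by (simp add: a_def)
  have zz: "(\<Sum>i<n. (z i)\<^sup>2) = s - \<delta>" by (simp add: s_def)
  let ?C = "(2 * pi * v) powr (- real n / 2) * (1 / sqrt (2 * pi * v / \<delta>)) * exp (- t / (2 * v))"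
  have C: "?C \<ge> 0" using assms(1,2) by simp
  have pw: "(1 / sqrt (2 * pi * v)) ^ n = (2 * pi * v) powr (- real n / 2)"
    using assms(1)
    by (simp add: powr_half_sqrt[symmetric] powr_realpow[symmetric] powr_powr powr_minus_divide[symmetric])
  have "(\<Prod>i<n. normal_density (l * z i) (sqrt v) (x i)) * normal_density \<nu> (sqrt (v / \<delta>)) l
     = ?C * exp (- (1/2) * ((s / v) * (l + (- a))\<^sup>2))" for l
  proof -
    have "(\<Sum>i<n. (x i - l * z i)\<^sup>2) = (\<Sum>i<n. (x i)\<^sup>2) - 2 * l * (\<Sum>i<n. z i * x i) + l\<^sup>2 * (\<Sum>i<n. (z i)\<^sup>2)"
      by (simp add: power2_diff sum.distrib sum_subtractf sum_distrib_left power_mult_distrib mult_ac)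
    also have "\<dots> + \<delta> * (l - \<nu>)\<^sup>2 = s * (l - a)\<^sup>2 + t"
      unfolding t_def zx zz by (simp add: power2_eq_square algebra_simps)
    finally have e: "(\<Sum>i<n. (x i - l * z i)\<^sup>2) + \<delta> * (l - \<nu>)\<^sup>2 = s * (l - a)\<^sup>2 + t" .
    have "(\<Prod>i<n. normal_density (l * z i) (sqrt v) (x i)) = 
       (2 * pi * v) powr (- real n / 2) * exp (- (\<Sum>i<n. (x i - l * z i)\<^sup>2) / (2 * v))"
      using assms(1) unfolding pw[symmetric]
      by (simp add: normal_density_def prod.distrib exp_sum[symmetric] sum_negf sum_divide_distrib less_imp_le
          power_one_over prod_dividef)
    moreover have "normal_density \<nu> (sqrt (v / \<delta>)) l = 1 / sqrt (2 * pi * v / \<delta>) * exp (- (\<delta> * (l - \<nu>)\<^sup>2) / (2 * v))"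
      using assms(1,2) by (simp add: normal_density_def)
    ultimately have "(\<Prod>i<n. normal_density (l * z i) (sqrt v) (x i)) * normal_density \<nu> (sqrt (v / \<delta>)) l
       = (2 * pi * v) powr (- real n / 2) * (1 / sqrt (2 * pi * v / \<delta>)) *
         exp (- ((\<Sum>i<n. (x i - l * z i)\<^sup>2) + \<delta> * (l - \<nu>)\<^sup>2) / (2 * v))"
      by (simp add: exp_add[symmetric] add_divide_distrib diff_divide_distrib)
    also have "\<dots> = ?C * exp (- (1/2) * ((s / v) * (l + (- a))\<^sup>2))"
      unfolding e using assms(1) by (simp add: exp_add[symmetric] field_simps)
    finally show ?thesis .
  qed
  then have "(\<integral>\<^sup>+l. ennreal ((\<Prod>i<n. normal_density (l * z i) (sqrt v) (x i)) * normal_density \<nu> (sqrt (v / \<delta>)) l) \<partial>lborel)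
     = (\<integral>\<^sup>+l. ennreal ?C * ennreal (exp (- (1/2) * ((s / v) * (l + (- a))\<^sup>2))) \<partial>lborel)"
    by (simp only: ennreal_mult'[OF C])
  also have "\<dots> = ennreal ?C * ennreal (sqrt (2 * pi / (s / v)))"
    by (subst nn_integral_cmult, simp, subst nn_integral_gaussian) (use s assms(1) in auto)
  also have "\<dots> = ennreal (?C * sqrt (2 * pi / (s / v)))"
    by (rule ennreal_mult'[OF C, symmetric])
  \<comment> \<open>The factor split off here cancels the normaliser of the prior on the slope,
    which leaves \<open>sqrt (\<delta> / s)\<close>.\<close>
  also have "sqrt (2 * pi / (s / v)) = sqrt (2 * pi * v / \<delta>) * sqrt (\<delta> / s)"
    unfolding real_sqrt_mult[symmetric] using assms(2) by simp
  also have "?C * (sqrt (2 * pi * v / \<delta>) * sqrt (\<delta> / s))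
     = (2 * pi * v) powr (- real n / 2) * sqrt (\<delta> / s) * exp (- t / (2 * v))"
    using assms(1,2) by simp
  finally show ?thesis .
qed

text \<open>The quantity is the penalised sum of squares evaluated at the slope \<open>a\<close>.
  Its sign guarantees a positive scale in the inverse gamma integral.\<close>

lemma residual_nonneg:
  fixes x z :: "nat \<Rightarrow> real" and \<delta> \<nu> :: real and n :: nat
  assumes "\<delta> > 0"
  defines "s \<equiv> \<delta> + (\<Sum>i<n. (z i)\<^sup>2)"
  defines "a \<equiv> ((\<Sum>i<n. z i * x i) + \<delta> * \<nu>) / s"
  shows "(\<Sum>i<n. (x i)\<^sup>2) + \<delta> * \<nu>\<^sup>2 - s * a\<^sup>2 \<ge> 0"
proof -
  have s: "s > 0" unfolding s_def using assms(1) by (intro add_pos_nonneg sum_nonneg) auto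
  have zx: "(\<Sum>i<n. z i * x i) = s * a - \<delta> * \<nu>" using s by (simp add: a_def)
  have zz: "(\<Sum>i<n. (z i)\<^sup>2) = s - \<delta>" by (simp add: s_def)
  have "0 \<le> (\<Sum>i<n. (x i - a * z i)\<^sup>2) + \<delta> * (a - \<nu>)\<^sup>2"
    using assms(1) by (intro add_nonneg_nonneg sum_nonneg) auto
  also have "(\<Sum>i<n. (x i - a * z i)\<^sup>2) = (\<Sum>i<n. (x i)\<^sup>2) - 2 * a * (\<Sum>i<n. z i * x i) + a\<^sup>2 * (\<Sum>i<n. (z i)\<^sup>2)"
    by (simp add: power2_diff sum.distrib sum_subtractf sum_distrib_left power_mult_distrib mult_ac)
  also have "\<dots> + \<delta> * (a - \<nu>)\<^sup>2 = (\<Sum>i<n. (x i)\<^sup>2) + \<delta> * \<nu>\<^sup>2 - s * a\<^sup>2"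
    unfolding zx zz by (simp add: power2_eq_square algebra_simps)
  finally show ?thesis .
qed

text \<open>Up to a constant, integrating out the slope multiplies the prior of \<open>v\<close> by
  \<open>v powr (- n / 2) * exp (- t / (2 * v))\<close>, so the inverse gamma form is preserved and
  the outer integral is a Gamma value.\<close>

lemma nn_integral_normal_inverse_gamma:
  fixes x z :: "nat \<Rightarrow> real" and \<alpha> \<beta> \<delta> \<nu> :: real and n :: nat
  assumes "\<delta> > 0" "\<alpha> > 0" "\<beta> > 0"
  defines "s \<equiv> \<delta> + (\<Sum>i<n. (z i)\<^sup>2)"
  defines "a \<equiv> ((\<Sum>i<n. z i * x i) + \<delta> * \<nu>) / s"
  defines "t \<equiv> (\<Sum>i<n. (x i)\<^sup>2) + \<delta> * \<nu>\<^sup>2 - s * a\<^sup>2"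
  shows "(\<integral>\<^sup>+v. (\<integral>\<^sup>+l. ennreal ((\<Prod>i<n. normal_density (l * z i) (sqrt v) (x i)) *
            (inv_gamma_density v (\<alpha> / 2) (\<beta>\<^sup>2 / 2) * normal_density \<nu> (sqrt (v / \<delta>)) l)) \<partial>lborel)
          \<partial>restrict_space lborel {0<..})
     = ennreal (pi powr (- real n / 2) * (sqrt \<delta> / sqrt s * (Gamma (real n / 2 + \<alpha> / 2) / Gamma (\<alpha> / 2))
         * (\<beta> powr \<alpha> / (\<beta>\<^sup>2 + t) powr (real n / 2 + \<alpha> / 2))))"
proof -
  have s: "s > 0" unfolding s_def using assms(1) by (intro add_pos_nonneg sum_nonneg) auto
  have t: "t \<ge> 0" unfolding t_def a_def s_def by (rule residual_nonneg[OF assms(1)])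
  \<comment> \<open>Shape and scale of the inverse gamma posterior of \<open>v\<close>.\<close>
  define A where "A = real n / 2 + \<alpha> / 2"
  define b where "b = (\<beta>\<^sup>2 + t) / 2"
  have A: "A > 0" and b: "b > 0" unfolding A_def b_def using assms(2,3) t
    by (auto intro!: add_nonneg_pos add_pos_nonneg)
  have G: "Gamma (\<alpha> / 2) > 0" using assms(2) by simp
  let ?C = "(2 * pi) powr (- real n / 2) * sqrt (\<delta> / s) * ((\<beta>\<^sup>2 / 2) powr (\<alpha> / 2) / Gamma (\<alpha> / 2))"
  have C: "?C \<ge> 0" using G s assms(1) by auto
  have inner: "(\<integral>\<^sup>+l. ennreal ((\<Prod>i<n. normal_density (l * z i) (sqrt v) (x i)) *
            (inv_gamma_density v (\<alpha> / 2) (\<beta>\<^sup>2 / 2) * normal_density \<nu> (sqrt (v / \<delta>)) l)) \<partial>lborel)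
     = ennreal ?C * ennreal ((1 / v) powr (A + 1) * exp (- b / v))" if "v > 0" for v
  proof -
    let ?g = "inv_gamma_density v (\<alpha> / 2) (\<beta>\<^sup>2 / 2)"
    have g: "?g \<ge> 0" using G by (auto simp: inv_gamma_density_def)
    have "(\<integral>\<^sup>+l. ennreal ((\<Prod>i<n. normal_density (l * z i) (sqrt v) (x i)) *
            (?g * normal_density \<nu> (sqrt (v / \<delta>)) l)) \<partial>lborel)
      = (\<integral>\<^sup>+l. ennreal ?g * ennreal ((\<Prod>i<n. normal_density (l * z i) (sqrt v) (x i)) *
             normal_density \<nu> (sqrt (v / \<delta>)) l) \<partial>lborel)"
      by (subst ennreal_mult'[OF g, symmetric]) (simp add: mult_ac)
    also have "\<dots> = ennreal ?g * ennreal ((2 * pi * v) powr (- real n / 2) * sqrt (\<delta> / s) * exp (- t / (2 * v)))"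
    proof (subst nn_integral_cmult)
      show "(\<lambda>l. ennreal ((\<Prod>i<n. normal_density (l * z i) (sqrt v) (x i)) * normal_density \<nu> (sqrt (v / \<delta>)) l))
          \<in> borel_measurable lborel"
        unfolding normal_density_def by measurable
    qed (simp only: nn_integral_regression[OF that assms(1)] s_def a_def t_def)
    also have "\<dots> = ennreal (?g * ((2 * pi * v) powr (- real n / 2) * sqrt (\<delta> / s) * exp (- t / (2 * v))))"
      by (rule ennreal_mult'[OF g, symmetric])
    also have "?g * ((2 * pi * v) powr (- real n / 2) * sqrt (\<delta> / s) * exp (- t / (2 * v)))
       = ?C * ((1 / v) powr (A + 1) * exp (- b / v))"
    proof -
      have "(2 * pi * v) powr (- real n / 2) = (2 * pi) powr (- real n / 2) * (1 / v) powr (real n / 2)"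
        using that by (simp add: powr_mult powr_divide powr_minus_divide)
      moreover have "(1 / v) powr (A + 1) = (1 / v) powr (\<alpha> / 2 + 1) * (1 / v) powr (real n / 2)"
        by (simp add: powr_add[symmetric] A_def add_ac)
      moreover have "exp (- b / v) = exp (- (\<beta>\<^sup>2 / 2) / v) * exp (- t / (2 * v))"
        using that by (simp add: b_def exp_add[symmetric] field_simps)
      ultimately show ?thesis by (simp add: inv_gamma_density_def)
    qed
    finally show ?thesis by (simp only: ennreal_mult'[OF C])
  qed
  have "(\<integral>\<^sup>+v. (\<integral>\<^sup>+l. ennreal ((\<Prod>i<n. normal_density (l * z i) (sqrt v) (x i)) *
            (inv_gamma_density v (\<alpha> / 2) (\<beta>\<^sup>2 / 2) * normal_density \<nu> (sqrt (v / \<delta>)) l)) \<partial>lborel)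
          \<partial>restrict_space lborel {0<..})
     = (\<integral>\<^sup>+v. ennreal ?C * (ennreal ((1 / v) powr (A + 1) * exp (- b / v)) * indicator {0<..} v) \<partial>lborel)"
    by (subst nn_integral_restrict_space) (auto intro!: nn_integral_cong simp: inner indicator_def)
  also have "\<dots> = ennreal ?C * ennreal (Gamma A / b powr A)"
    by (subst nn_integral_cmult) (measurable, simp only: nn_integral_inverse_gamma[OF A b])
  also have "\<dots> = ennreal (?C * (Gamma A / b powr A))"
    by (rule ennreal_mult'[OF C, symmetric])
  \<comment> \<open>The powers of 2 cancel: the two halved scale parameters together bring
    \<open>2 powr A / 2 powr (\<alpha> / 2) = 2 powr (n / 2)\<close>, and the normal densities bring
    its reciprocal. Of the factor \<open>2 * pi\<close> only the power of \<open>pi\<close>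
    survives.\<close>
  also have "?C * (Gamma A / b powr A) = pi powr (- real n / 2) * (sqrt \<delta> / sqrt s * (Gamma A / Gamma (\<alpha> / 2))
         * (\<beta> powr \<alpha> / (\<beta>\<^sup>2 + t) powr A))"
  proof -
    have 1: "(\<beta>\<^sup>2 / 2) powr (\<alpha> / 2) = \<beta> powr \<alpha> / 2 powr (\<alpha> / 2)"
      using assms(3) powr_powr[of \<beta> 2 "\<alpha> / 2"] by (simp add: powr_divide)
    have 2: "b powr A = (\<beta>\<^sup>2 + t) powr A / 2 powr A"
      unfolding b_def using t by (simp add: powr_divide)
    have 3: "2 powr A = 2 powr (real n / 2) * 2 powr (\<alpha> / 2)"
      by (simp add: A_def powr_add)
    have 4: "(2 * pi) powr (- real n / 2) = pi powr (- real n / 2) / 2 powr (real n / 2)"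
      by (simp add: powr_mult powr_minus_divide)
    show ?thesis unfolding 1 2 3 4 by (simp add: real_sqrt_divide)
  qed
  finally show ?thesis unfolding A_def .
qed

section \<open>Rows of the coefficient matrix\<close>

text \<open>Strict monotonicity of \<open>pick\<close> gives injectivity, and counting then forces
  the image to be all of \<open>I\<close>.\<close>

lemma bij_betw_pick:
  assumes "finite I"
  shows "bij_betw (pick I) {..<card I} I"
proof -
  have inj: "inj_on (pick I) {..<card I}"
    by (rule inj_onI) (metis lessThan_iff less_irrefl_nat linorder_neqE_nat pick_mono_le)
  have "pick I ` {..<card I} \<subseteq> I"
    using pick_in_set_le by auto
  then have "pick I ` {..<card I} = I"
    by (rule card_subset_eq[OF assms]) (simp add: card_image[OF inj])
  with inj show ?thesis by (simp add: bij_betw_def)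
qed

locale gaussian_sem =
  fixes n p q :: nat
    and f \<omega> :: "nat mat"
    and \<alpha> \<beta> \<delta> \<nu> :: "nat \<Rightarrow> real"
    and \<mu> :: "nat \<Rightarrow> real vec" and \<kappa> :: "nat \<Rightarrow> real mat"
    and X Z :: "real mat"
  assumes f: "f \<in> carrier_mat q q" "elements_mat f \<subseteq> {0, 1}"
    and f_tri: "\<And>h l. h < q \<Longrightarrow> l < q \<Longrightarrow> h \<le> l \<Longrightarrow> f $$ (h, l) = 0"
    and \<omega>: "\<omega> \<in> carrier_mat p q" "elements_mat \<omega> \<subseteq> {0, 1}"
    and \<omega>_ex1: "\<And>j. j < p \<Longrightarrow> \<exists>!h. h < q \<and> \<omega> $$ (j, h) = 1"
    and \<alpha>: "\<And>j. j < p \<Longrightarrow> \<alpha> j > 0" and \<beta>: "\<And>j. j < p \<Longrightarrow> \<beta> j > 0" and \<delta>: "\<And>j. j < p \<Longrightarrow> \<delta> j > 0"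
    and \<mu>: "\<And>h. h < q \<Longrightarrow> indeg f h > 0 \<Longrightarrow> \<mu> h \<in> carrier_vec (indeg f h)"
    and \<kappa>: "\<And>h. h < q \<Longrightarrow> indeg f h > 0 \<Longrightarrow> sym_pos_def_mat (indeg f h) (\<kappa> h)"
    and X: "X \<in> carrier_mat n p" and Z: "Z \<in> carrier_mat n q"
begin

lemma finite_parents [simp]: "finite (parents f h)"
  by (auto simp: parents_def)

lemma indeg: "h < q \<Longrightarrow> indeg f h = card (parents f h)"
  by (rule indeg_eq_card_parents[OF f])

lemma parents_subset: "parents f h \<subseteq> {..<q}"
  using f by (auto simp: parents_def)

lemma pick_less: "h < q \<Longrightarrow> k < indeg f h \<Longrightarrow> pick (parents f h) k < q"
  using pick_in_set_le[of k "parents f h"] parents_subset[of h] by (auto simp: indeg)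

lemma sum_parents: "h < q \<Longrightarrow> (\<Sum>l\<in>parents f h. g l) = (\<Sum>k<indeg f h. g (pick (parents f h) k))"
  using sum.reindex_bij_betw[OF bij_betw_pick[OF finite_parents[of h]], of g] by (simp add: indeg)

lemma parents_lt: "{i. i < q \<and> i \<in> parents f h} = parents f h"
  using parents_subset by auto

text \<open>The integration variable is a function on pairs; this is the vector of free entries of
  row \<open>h\<close> contained in it. \<open>pick\<close> fixes the same increasing order as in
  \<open>M_tilde\<close> and \<open>m_tilde\<close>, so the matrix expressions line up.\<close>

definition coeff_vec :: "nat \<Rightarrow> (nat \<times> nat \<Rightarrow> real) \<Rightarrow> real vec" where
  "coeff_vec h y = vec (indeg f h) (\<lambda>k. y (h, pick (parents f h) k))"

lemma coeff_vec_carrier: "coeff_vec h y \<in> carrier_vec (indeg f h)"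
  by (simp add: coeff_vec_def)

lemma subvector_fill_pattern:
  assumes "h < q"
  shows "subvector (row (fill_pattern f y) h) (parents f h) = coeff_vec h y"
proof -
  have "pick (parents f h) k \<in> parents f h" if "k < indeg f h" for k
    using pick_in_set_le[of k "parents f h"] that assms by (simp add: indeg)
  then show ?thesis
    using assms f pick_less[OF assms]
    by (intro eq_vecI) (auto simp: subvector_def coeff_vec_def fill_pattern_def parents_lt indeg parents_def)
qed

lemma fill_pattern_mult:
  assumes "h < q"
  shows "(\<Sum>l<q. fill_pattern f y $$ (h, l) * w l) = (\<Sum>k<indeg f h. coeff_vec h y $ k * w (pick (parents f h) k))"
proof -
  have "(\<Sum>l<q. fill_pattern f y $$ (h, l) * w l) = (\<Sum>l\<in>parents f h. y (h, l) * w l)"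
    using assms f by (intro sum.mono_neutral_cong_right) (auto simp: fill_pattern_def parents_def)
  also have "\<dots> = (\<Sum>k<indeg f h. coeff_vec h y $ k * w (pick (parents f h) k))"
    by (subst sum_parents[OF assms]) (simp add: coeff_vec_def)
  finally show ?thesis .
qed

lemma M_tilde_carrier: "h < q \<Longrightarrow> M_tilde f Z h \<in> carrier_mat (indeg f h) (indeg f h)"
  using Z by (auto simp: M_tilde_def submatrix_def gram_def parents_lt indeg)

lemma M_tilde_index:
  assumes "h < q" "k < indeg f h" "l < indeg f h"
  shows "M_tilde f Z h $$ (k, l) = (\<Sum>i<n. Z $$ (i, pick (parents f h) k) * Z $$ (i, pick (parents f h) l))"
proof -
  have "M_tilde f Z h $$ (k, l) = gram Z $$ (pick (parents f h) k, pick (parents f h) l)"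
    unfolding M_tilde_def using assms Z
    by (intro submatrix_index) (auto simp: gram_def parents_lt indeg)
  also have "\<dots> = (\<Sum>i<n. Z $$ (i, pick (parents f h) k) * Z $$ (i, pick (parents f h) l))"
    using pick_less[OF assms(1,2)] pick_less[OF assms(1,3)] Z by (simp add: gram_def)
  finally show ?thesis .
qed

lemma M_tilde_sym: "h < q \<Longrightarrow> transpose_mat (M_tilde f Z h) = M_tilde f Z h"
  using M_tilde_carrier[of h] by (intro eq_matI) (auto simp: M_tilde_index mult.commute)

text \<open>\<open>M_tilde\<close> is the Gram matrix of the parent columns of \<open>Z\<close>, so
  its form is a sum of squared linear predictors. This serves both the expansion of the residuals
  and positive semidefiniteness.\<close>

lemma M_tilde_quadratic:
  assumes "h < q" "x \<in> carrier_vec (indeg f h)"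
  shows "x \<bullet> (M_tilde f Z h *\<^sub>v x) = (\<Sum>i<n. (\<Sum>k<indeg f h. x $ k * Z $$ (i, pick (parents f h) k))\<^sup>2)"
proof -
  let ?d = "indeg f h" and ?z = "\<lambda>i k. Z $$ (i, pick (parents f h) k)"
  have "x \<bullet> (M_tilde f Z h *\<^sub>v x) = (\<Sum>k<?d. \<Sum>l<?d. \<Sum>i<n. (x $ k * ?z i k) * (x $ l * ?z i l))"
    unfolding scalar_prod_mult_mat_vec_eq_qform[OF M_tilde_carrier[OF assms(1)] assms(2)] qform_def
    using assms(1) by (intro sum.cong refl) (simp add: M_tilde_index sum_distrib_left sum_distrib_right mult_ac)
  also have "\<dots> = (\<Sum>k<?d. \<Sum>i<n. \<Sum>l<?d. (x $ k * ?z i k) * (x $ l * ?z i l))"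
    by (intro sum.cong refl sum.swap)
  also have "\<dots> = (\<Sum>i<n. \<Sum>k<?d. \<Sum>l<?d. (x $ k * ?z i k) * (x $ l * ?z i l))"
    by (rule sum.swap)
  finally show ?thesis by (simp add: power2_eq_square sum_product)
qed

lemma m_tilde_carrier: "h < q \<Longrightarrow> m_tilde f Z h \<in> carrier_vec (indeg f h)"
  using Z by (simp add: m_tilde_def subvector_def cross_vec_def parents_lt indeg)

lemma m_tilde_scalar_prod:
  assumes "h < q" "x \<in> carrier_vec (indeg f h)"
  shows "x \<bullet> m_tilde f Z h = (\<Sum>i<n. Z $$ (i, h) * (\<Sum>k<indeg f h. x $ k * Z $$ (i, pick (parents f h) k)))"
proof -
  let ?d = "indeg f h" and ?z = "\<lambda>i k. Z $$ (i, pick (parents f h) k)"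
  have m: "m_tilde f Z h $ k = (\<Sum>i<n. Z $$ (i, h) * ?z i k)" if "k < ?d" for k
    using that assms(1) Z pick_less[OF assms(1) that]
    by (simp add: m_tilde_def subvector_def cross_vec_def parents_lt indeg)
  have "x \<bullet> m_tilde f Z h = (\<Sum>k<?d. \<Sum>i<n. Z $$ (i, h) * (x $ k * ?z i k))"
    using m_tilde_carrier[OF assms(1)]
    by (auto simp: scalar_prod_def atLeast0LessThan m sum_distrib_left mult_ac intro!: sum.cong)
  also have "\<dots> = (\<Sum>i<n. \<Sum>k<?d. Z $$ (i, h) * (x $ k * ?z i k))"
    by (rule sum.swap)
  finally show ?thesis by (simp add: sum_distrib_left)
qed

text \<open>Expanding the square puts the likelihood of row \<open>h\<close> into the shape of the
  data part of \<open>complete_the_square\<close>, and shows that it depends on \<open>y\<close>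
  only through \<open>coeff_vec h y\<close>.\<close>

lemma sum_residual_squares:
  assumes "h < q"
  shows "(\<Sum>i<n. (Z $$ (i, h) - (\<Sum>l<q. fill_pattern f y $$ (h, l) * Z $$ (i, l)))\<^sup>2)
    = (\<Sum>i<n. (Z $$ (i, h))\<^sup>2) +
      (coeff_vec h y \<bullet> (M_tilde f Z h *\<^sub>v coeff_vec h y) - 2 * (coeff_vec h y \<bullet> m_tilde f Z h))"
  unfolding fill_pattern_mult[OF assms] M_tilde_quadratic[OF assms coeff_vec_carrier]
    m_tilde_scalar_prod[OF assms coeff_vec_carrier]
  by (simp add: power2_diff sum.distrib sum_subtractf sum_distrib_left mult_ac)

text \<open>A positive semidefinite Gram matrix plus a positive definite prior precision is
  definite, even when there are fewer observations than parents.\<close>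

lemma S_tilde_pos_def:
  assumes "h < q" "indeg f h > 0"
  shows "sym_pos_def_mat (indeg f h) (S_tilde f \<kappa> Z h)"
  unfolding sym_pos_def_mat_def
proof (intro conjI ballI impI)
  note K = \<kappa>[OF assms, unfolded sym_pos_def_mat_def]
  note M = M_tilde_carrier[OF assms(1)]
  show "S_tilde f \<kappa> Z h \<in> carrier_mat (indeg f h) (indeg f h)"
    using M K by (auto simp: S_tilde_def)
  show "transpose_mat (S_tilde f \<kappa> Z h) = S_tilde f \<kappa> Z h"
    using M K M_tilde_sym[OF assms(1)] by (simp add: S_tilde_def transpose_add)
  fix v :: "real vec" assume v: "v \<in> carrier_vec (indeg f h)" "v \<noteq> 0\<^sub>v (indeg f h)"
  have "v \<bullet> (S_tilde f \<kappa> Z h *\<^sub>v v) = v \<bullet> (M_tilde f Z h *\<^sub>v v) + v \<bullet> (\<kappa> h *\<^sub>v v)"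
    unfolding S_tilde_def using add_mult_distrib_mat_vec[OF M _ v(1), of "\<kappa> h"]
      scalar_prod_add_distrib[OF v(1) mult_mat_vec_carrier[OF M v(1)] mult_mat_vec_carrier[OF _ v(1), of "\<kappa> h"]] K
    by simp
  moreover have "v \<bullet> (M_tilde f Z h *\<^sub>v v) \<ge> 0"
    unfolding M_tilde_quadratic[OF assms(1) v(1)] by (intro sum_nonneg) auto
  ultimately show "v \<bullet> (S_tilde f \<kappa> Z h *\<^sub>v v) > 0" using K v by force
qed

text \<open>The normalising constants of the latent densities are left out; they do not depend on
  the parameters and are collected in one power of \<open>2 * pi\<close> outside the product over
  rows.\<close>

definition row_factor :: "nat \<Rightarrow> (nat \<times> nat \<Rightarrow> real) \<Rightarrow> real" where
  "row_factor h y =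
     exp (- (1/2) * (\<Sum>i<n. (Z $$ (i, h) - (\<Sum>l<q. fill_pattern f y $$ (h, l) * Z $$ (i, l)))\<^sup>2)) *
     (if indeg f h > 0 then mvn_density (indeg f h) (coeff_vec h y) (\<mu> h) (inv_mat (\<kappa> h)) else 1)"

definition row_evidence :: "nat \<Rightarrow> real" where
  "row_evidence h = exp (- (1 / 2) * (\<Sum>i<n. (Z $$ (i, h))\<^sup>2)) *
     (if indeg f h > 0
      then sqrt (det (\<kappa> h)) / sqrt (det (S_tilde f \<kappa> Z h)) * exp (- t_tilde f \<mu> \<kappa> Z h / 2)
      else 1)"

lemma row_evidence_nonneg: "h < q \<Longrightarrow> row_evidence h \<ge> 0"
  using det_sym_pos_def_mat[OF S_tilde_pos_def] det_sym_pos_def_mat[OF \<kappa>]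
  by (auto simp: row_evidence_def less_imp_le)

text \<open>Likelihood times prior is an unnormalised Gaussian in the free entries of the row, with
  precision \<open>S_tilde\<close> and mean \<open>zeta\<close>; \<open>t_tilde\<close> is the
  constant that completing the square leaves behind.\<close>

lemma row_factor_eq:
  assumes h: "h < q" "indeg f h > 0"
  shows "row_factor h y = exp (- (1/2) * (\<Sum>i<n. (Z $$ (i, h))\<^sup>2)) * exp (- t_tilde f \<mu> \<kappa> Z h / 2) *
      (sqrt (det (\<kappa> h)) / (2 * pi) powr (real (indeg f h) / 2)) *
      exp (- (1/2) * ((coeff_vec h y - zeta f \<mu> \<kappa> Z h) \<bullet>
         (S_tilde f \<kappa> Z h *\<^sub>v (coeff_vec h y - zeta f \<mu> \<kappa> Z h))))"
proof -
  note K = \<kappa>[OF h, unfolded sym_pos_def_mat_def]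
  have det: "det (M_tilde f Z h + \<kappa> h) \<noteq> 0"
    using det_sym_pos_def_mat[OF S_tilde_pos_def[OF h]] by (simp add: S_tilde_def)
  let ?x = "coeff_vec h y"
  have "?x \<bullet> (M_tilde f Z h *\<^sub>v ?x) - 2 * (?x \<bullet> m_tilde f Z h) + (?x - \<mu> h) \<bullet> (\<kappa> h *\<^sub>v (?x - \<mu> h))
     = (?x - zeta f \<mu> \<kappa> Z h) \<bullet> (S_tilde f \<kappa> Z h *\<^sub>v (?x - zeta f \<mu> \<kappa> Z h)) + t_tilde f \<mu> \<kappa> Z h"
    unfolding zeta_def t_tilde_def S_tilde_def
    by (rule complete_the_square[OF M_tilde_carrier[OF h(1)] M_tilde_sym[OF h(1)] _ _ det
          coeff_vec_carrier m_tilde_carrier[OF h(1)] \<mu>[OF h]]) (use K in auto)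
  note square = this
  \<comment> \<open>Given the completed square, the exponents agree by linear arithmetic; abstract
    reals keep the quadratic forms atomic.\<close>
  have combine: "- (1/2) * s + - t / 2 + - (1/2) * a = - (1/2) * (s + m) + - (1/2) * k"
    if "m + k = a + t" for s t a m k :: real
    using that by (simp add: field_simps)
  have "exp (- (1/2) * (\<Sum>i<n. (Z $$ (i, h))\<^sup>2)) * exp (- t_tilde f \<mu> \<kappa> Z h / 2) *
      exp (- (1/2) * ((?x - zeta f \<mu> \<kappa> Z h) \<bullet> (S_tilde f \<kappa> Z h *\<^sub>v (?x - zeta f \<mu> \<kappa> Z h))))
    = exp (- (1/2) * (\<Sum>i<n. (Z $$ (i, h) - (\<Sum>l<q. fill_pattern f y $$ (h, l) * Z $$ (i, l)))\<^sup>2)) *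
      exp (- (1/2) * ((?x - \<mu> h) \<bullet> (\<kappa> h *\<^sub>v (?x - \<mu> h))))"
    unfolding sum_residual_squares[OF h(1)] exp_add[symmetric]
    by (rule arg_cong[of _ _ exp], rule combine[OF square])
  then show ?thesis
    using h(2) unfolding row_factor_def mvn_density_precision[OF \<kappa>[OF h]] by simp
qed

lemma row_factor_nonneg:
  assumes "h < q"
  shows "row_factor h y \<ge> 0"
proof (cases "indeg f h > 0")
  case True
  show ?thesis
    unfolding row_factor_eq[OF assms True]
    using det_sym_pos_def_mat[OF \<kappa>[OF assms True]] by simp
qed (simp add: row_factor_def)

text \<open>The block of coordinates of the product measure that belongs to row \<open>h\<close>;
  distinct rows have disjoint blocks.\<close>

definition row_entries :: "nat \<Rightarrow> (nat \<times> nat) set" where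
  "row_entries h = {h} \<times> parents f h"

lemma row_entries_eq: "h < q \<Longrightarrow> row_entries h = (\<lambda>k. (h, pick (parents f h) k)) ` {..<indeg f h}"
  using bij_betw_imp_surj_on[OF bij_betw_pick[OF finite_parents[of h]]]
  by (force simp: row_entries_def indeg)

lemma free_entries_eq: "free_entries f = (\<Union>h<q. row_entries h)"
  using f by (auto simp: free_entries_def row_entries_def parents_def)

text \<open>Locality of the factor in its block of coordinates, as
  \<open>nn_integral_prod_disjoint\<close> demands.\<close>

lemma row_factor_cong:
  assumes "h < q" "\<And>e. e \<in> row_entries h \<Longrightarrow> x e = y e"
  shows "row_factor h x = row_factor h y"
proof -
  have "coeff_vec h x = coeff_vec h y"
    unfolding coeff_vec_def using assms by (intro eq_vecI) (auto simp: row_entries_eq)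
  then show ?thesis unfolding row_factor_def sum_residual_squares[OF assms(1)] by simp
qed

lemma zeta_carrier:
  assumes "h < q" "indeg f h > 0"
  shows "zeta f \<mu> \<kappa> Z h \<in> carrier_vec (indeg f h)"
proof -
  have "inv_mat (S_tilde f \<kappa> Z h) \<in> carrier_mat (indeg f h) (indeg f h)"
    using S_tilde_pos_def[OF assms] det_sym_pos_def_mat[OF S_tilde_pos_def[OF assms]]
    by (intro inv_mat) (auto simp: sym_pos_def_mat_def)
  then show ?thesis by (intro carrier_vecI) (auto simp: zeta_def)
qed

text \<open>Measurability is read off from the completed square, whose exponent is a polynomial in
  finitely many coordinates. A row without parents has a constant factor.\<close>

lemma borel_measurable_row_factor:
  assumes "h < q" "row_entries h \<subseteq> I"
  shows "row_factor h \<in> borel_measurable (\<Pi>\<^sub>M e\<in>I. lborel)"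
proof (cases "indeg f h > 0")
  case True
  let ?c = "zeta f \<mu> \<kappa> Z h" and ?S = "S_tilde f \<kappa> Z h" and ?d = "indeg f h"
  have S: "?S \<in> carrier_mat ?d ?d"
    using S_tilde_pos_def[OF assms(1) True] by (simp add: sym_pos_def_mat_def)
  have quad: "(coeff_vec h y - ?c) \<bullet> (?S *\<^sub>v (coeff_vec h y - ?c))
     = qform ?d (\<lambda>i j. ?S $$ (i, j)) (\<lambda>k. y (h, pick (parents f h) k) - ?c $ k)" for y
    using zeta_carrier[OF assms(1) True]
    by (subst scalar_prod_mult_mat_vec_eq_qform[OF S]) (auto simp: qform_def coeff_vec_def)
  have "(\<lambda>k. (h, pick (parents f h) k)) ` {..<?d} \<subseteq> I"
    using assms by (simp add: row_entries_eq)
  then have "(\<lambda>y. (coeff_vec h y - ?c) \<bullet> (?S *\<^sub>v (coeff_vec h y - ?c)))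
      \<in> borel_measurable (\<Pi>\<^sub>M e\<in>I. lborel)"
    unfolding quad by (rule borel_measurable_qform_component)
  then show ?thesis
    unfolding ext[of "row_factor h", OF row_factor_eq[OF assms(1) True]]
    by (intro borel_measurable_times borel_measurable_const measurable_compose[OF _ borel_measurable_exp])
next
  case False
  then have "row_factor h = (\<lambda>_. row_factor h (\<lambda>_. 0))"
    by (intro ext row_factor_cong[OF assms(1)]) (simp add: row_entries_eq[OF assms(1)])
  then show ?thesis by (metis borel_measurable_const)
qed

lemma nn_integral_row_factor:
  assumes h: "h < q"
  shows "(\<integral>\<^sup>+y. ennreal (row_factor h y) \<partial>(\<Pi>\<^sub>M e\<in>row_entries h. lborel)) = ennreal (row_evidence h)"
proof (cases "indeg f h > 0")
  case True
  let ?c = "zeta f \<mu> \<kappa> Z h" and ?S = "S_tilde f \<kappa> Z h" and ?d = "indeg f h"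
  let ?g = "\<lambda>k. (h, pick (parents f h) k)"
  let ?C = "exp (- (1/2) * (\<Sum>i<n. (Z $$ (i, h))\<^sup>2)) * exp (- t_tilde f \<mu> \<kappa> Z h / 2) *
      (sqrt (det (\<kappa> h)) / (2 * pi) powr (real ?d / 2))"
  let ?Q = "\<lambda>y. exp (- (1/2) * ((coeff_vec h y - ?c) \<bullet> (?S *\<^sub>v (coeff_vec h y - ?c))))"
  have detK: "det (\<kappa> h) > 0" by (rule det_sym_pos_def_mat[OF \<kappa>[OF h True]])
  have detS: "det ?S > 0" by (rule det_sym_pos_def_mat[OF S_tilde_pos_def[OF h True]])
  have C: "?C > 0" using detK by simp
  have inj: "inj_on ?g {..<?d}"
    using bij_betw_imp_inj_on[OF bij_betw_pick[OF finite_parents[of h]]] h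
    by (auto simp: inj_on_def indeg)
  have eq: "row_factor h y = ?C * ?Q y" for y by (rule row_factor_eq[OF h True])
  have Q: "?Q \<in> borel_measurable (\<Pi>\<^sub>M e\<in>row_entries h. lborel)"
  proof -
    have "?Q = (\<lambda>y. row_factor h y / ?C)" using C detK by (auto simp: eq)
    then show ?thesis using borel_measurable_row_factor[OF h order_refl] by simp
  qed
  have "(\<integral>\<^sup>+y. ennreal (row_factor h y) \<partial>(\<Pi>\<^sub>M e\<in>row_entries h. lborel))
     = (\<integral>\<^sup>+y. ennreal ?C * ennreal (?Q y) \<partial>(\<Pi>\<^sub>M e\<in>row_entries h. lborel))"
    unfolding eq using C by (intro nn_integral_cong ennreal_mult') auto
  also have "\<dots> = ennreal ?C * (\<integral>\<^sup>+y. ennreal (?Q y) \<partial>(\<Pi>\<^sub>M e\<in>row_entries h. lborel))"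
    by (rule nn_integral_cmult) (rule measurable_compose[OF Q measurable_ennreal])
  also have "(\<integral>\<^sup>+y. ennreal (?Q y) \<partial>(\<Pi>\<^sub>M e\<in>row_entries h. lborel)) = ennreal (sqrt ((2 * pi) ^ ?d / det ?S))"
    unfolding coeff_vec_def row_entries_eq[OF h]
    by (rule nn_integral_gaussian_mat[OF S_tilde_pos_def[OF h True] inj zeta_carrier[OF h True]])
  also have "ennreal ?C * \<dots> = ennreal (?C * sqrt ((2 * pi) ^ ?d / det ?S))"
    using C by (intro ennreal_mult'[symmetric]) simp
  \<comment> \<open>The power of \<open>2 * pi\<close> in the prior normaliser cancels the one from
    the Gaussian integral, so no constant depending on the number of parents remains besides the
    determinants.\<close>
  also have "?C * sqrt ((2 * pi) ^ ?d / det ?S) = row_evidence h"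
  proof -
    have "sqrt ((2 * pi) ^ ?d) = (2 * pi) powr (real ?d / 2)"
      unfolding real_sqrt_power by (simp add: powr_half_sqrt[symmetric] powr_realpow[symmetric] powr_powr)
    then show ?thesis using True by (simp add: row_evidence_def real_sqrt_divide)
  qed
  finally show ?thesis .
next
  case False
  interpret product_sigma_finite "\<lambda>_. lborel :: real measure" ..
  \<comment> \<open>Without parents the block is empty, and the product measure over it is the unit
    mass on one point.\<close>
  have "row_entries h = {}" using False by (simp add: row_entries_eq[OF h])
  moreover have "row_factor h y = row_evidence h" for y
    using False unfolding row_factor_def row_evidence_def fill_pattern_mult[OF h] by simp
  ultimately show ?thesis by (simp add: space_PiM)
qed

lemma nn_integral_rows:
  "(\<integral>\<^sup>+y. ennreal (\<Prod>h<q. row_factor h y) \<partial>(\<Pi>\<^sub>M e\<in>free_entries f. lborel)) = ennreal (\<Prod>h<q. row_evidence h)"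
proof -
  interpret product_sigma_finite "\<lambda>_. lborel :: real measure" ..
  have "(\<integral>\<^sup>+y. ennreal (\<Prod>h<q. row_factor h y) \<partial>(\<Pi>\<^sub>M e\<in>free_entries f. lborel))
     = (\<integral>\<^sup>+y. (\<Prod>h<q. ennreal (row_factor h y)) \<partial>(\<Pi>\<^sub>M e\<in>free_entries f. lborel))"
    by (intro nn_integral_cong prod_ennreal[symmetric]) (simp add: row_factor_nonneg)
  also have "\<dots> = (\<Prod>h<q. \<integral>\<^sup>+y. ennreal (row_factor h y) \<partial>(\<Pi>\<^sub>M e\<in>row_entries h. lborel))"
    unfolding free_entries_eq
  proof (rule nn_integral_prod_disjoint)
    show "disjoint_family_on row_entries {..<q}"
      by (auto simp: disjoint_family_on_def row_entries_def)
    show "finite (row_entries h)" for h by (simp add: row_entries_def)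
    show "(\<lambda>y. ennreal (row_factor h y)) \<in> borel_measurable (\<Pi>\<^sub>M e\<in>row_entries h. lborel)" if "h \<in> {..<q}" for h
      using that by (intro measurable_compose[OF borel_measurable_row_factor measurable_ennreal]) auto
    show "ennreal (row_factor h x) = ennreal (row_factor h y)"
      if "h \<in> {..<q}" "\<And>e. e \<in> row_entries h \<Longrightarrow> x e = y e" for h x y
      using row_factor_cong[of h x y] that by simp
  qed simp
  also have "\<dots> = (\<Prod>h<q. ennreal (row_evidence h))"
    by (intro prod.cong) (auto simp: nn_integral_row_factor)
  also have "\<dots> = ennreal (\<Prod>h<q. row_evidence h)"
    by (intro prod_ennreal) (simp add: row_evidence_nonneg)
  finally show ?thesis .
qed

section \<open>Loadings and variances\<close>

text \<open>Since a row of \<open>\<omega>\<close> has a single one, the row of loadings reduces to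
  one number, and column \<open>j\<close> of \<open>X\<close> is regressed on this one column of
  \<open>Z\<close>.\<close>

definition load_col :: "nat \<Rightarrow> nat" where
  "load_col j = (THE h. h < q \<and> \<omega> $$ (j, h) = 1)"

lemma load_col:
  assumes "j < p"
  shows "load_col j < q" "\<omega> $$ (j, load_col j) = 1"
  using theI'[OF \<omega>_ex1[OF assms]] by (auto simp: load_col_def)

lemma \<omega>_entry:
  assumes "j < p" "h < q"
  shows "\<omega> $$ (j, h) = of_bool (h = load_col j)"
proof -
  have "\<omega> $$ (j, h) \<in> elements_mat \<omega>" using assms \<omega>(1) by auto
  then have "\<omega> $$ (j, h) \<in> {0, 1}" using \<omega>(2) by blast
  then show ?thesis using load_col[OF assms(1)] \<omega>_ex1[OF assms(1)] assms(2) by auto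
qed

text \<open>One free loading per row: loadings are indexed by \<open>j\<close> just like variances,
  which pairs each variance with exactly one loading.\<close>

lemma free_entries_\<omega>: "free_entries \<omega> = (\<lambda>j. (j, load_col j)) ` {..<p}"
  using \<omega>(1) by (auto simp: free_entries_def \<omega>_entry load_col of_bool_def split: if_splits)

lemma fill_pattern_\<omega>:
  "j < p \<Longrightarrow> h < q \<Longrightarrow> fill_pattern \<omega> x $$ (j, h) = (if h = load_col j then x (j, load_col j) else 0)"
  using \<omega>(1) by (simp add: fill_pattern_def \<omega>_entry)

lemma fill_pattern_\<omega>_mult:
  assumes "j < p" "i < n"
  shows "(fill_pattern \<omega> x *\<^sub>v row Z i) $ j = x (j, load_col j) * Z $$ (i, load_col j)"
proof -
  have "(fill_pattern \<omega> x *\<^sub>v row Z i) $ j = (\<Sum>h<q. fill_pattern \<omega> x $$ (j, h) * Z $$ (i, h))"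
    using assms Z \<omega>(1) by (auto simp: scalar_prod_def fill_pattern_def atLeast0LessThan intro!: sum.cong)
  also have "\<dots> = (\<Sum>h<q. if h = load_col j then x (j, load_col j) * Z $$ (i, h) else 0)"
    using assms(1) by (intro sum.cong) (auto simp: fill_pattern_\<omega>)
  also have "\<dots> = x (j, load_col j) * Z $$ (i, load_col j)"
    using load_col(1)[OF assms(1)] by simp
  finally show ?thesis .
qed

text \<open>\<open>omega_row \<omega> j\<close> is a unit vector. The matrix expressions in
  \<open>s_coef\<close> and \<open>a_coef\<close> thereby reduce to the scalar sums of a regression
  on one column.\<close>

lemma omega_row_scalar_prod:
  assumes "j < p" "w \<in> carrier_vec q"
  shows "omega_row \<omega> j \<bullet> w = w $ load_col j"
proof -
  have "omega_row \<omega> j \<bullet> w = (\<Sum>h<q. if h = load_col j then w $ h else 0)"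
    using assms \<omega>(1) by (auto simp: omega_row_def scalar_prod_def atLeast0LessThan \<omega>_entry intro!: sum.cong)
  then show ?thesis using load_col(1)[OF assms(1)] by simp
qed

lemma omega_row_carrier: "j < p \<Longrightarrow> omega_row \<omega> j \<in> carrier_vec q"
  using \<omega>(1) by (simp add: omega_row_def)

lemma s_coef_eq:
  assumes "j < p"
  shows "s_coef \<omega> \<delta> Z j = \<delta> j + (\<Sum>i<n. (Z $$ (i, load_col j))\<^sup>2)"
proof -
  note c = load_col(1)[OF assms] and o = omega_row_carrier[OF assms]
  have G: "gram Z \<in> carrier_mat q q" using Z by (simp add: gram_def)
  have "omega_row \<omega> j \<bullet> (gram Z *\<^sub>v omega_row \<omega> j) = row (gram Z) (load_col j) \<bullet> omega_row \<omega> j"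
    using omega_row_scalar_prod[OF assms, of "gram Z *\<^sub>v omega_row \<omega> j"] G o c by simp
  also have "\<dots> = omega_row \<omega> j \<bullet> row (gram Z) (load_col j)"
    using G o c by (intro comm_scalar_prod[of _ q]) auto
  also have "\<dots> = gram Z $$ (load_col j, load_col j)"
    using omega_row_scalar_prod[OF assms, of "row (gram Z) (load_col j)"] G c by simp
  finally show ?thesis using Z c by (simp add: s_coef_def gram_def power2_eq_square)
qed

lemma a_coef_eq:
  assumes "j < p"
  shows "a_coef \<omega> \<delta> \<nu> X Z j = ((\<Sum>i<n. Z $$ (i, load_col j) * X $$ (i, j)) + \<delta> j * \<nu> j) /
     (\<delta> j + (\<Sum>i<n. (Z $$ (i, load_col j))\<^sup>2))"
proof -
  have "(\<Sum>i<n. (omega_row \<omega> j \<bullet> row Z i) * X $$ (i, j)) = (\<Sum>i<n. Z $$ (i, load_col j) * X $$ (i, j))"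
    using Z load_col(1)[OF assms] by (intro sum.cong) (auto simp: omega_row_scalar_prod[OF assms])
  then show ?thesis using Z by (simp add: a_coef_def s_coef_eq[OF assms])
qed

definition loading_factor :: "nat \<Rightarrow> real \<Rightarrow> real \<Rightarrow> real" where
  "loading_factor j v l = (\<Prod>i<n. normal_density (l * Z $$ (i, load_col j)) (sqrt v) (X $$ (i, j))) *
     (inv_gamma_density v (\<alpha> j / 2) ((\<beta> j)\<^sup>2 / 2) * normal_density (\<nu> j) (sqrt (v / \<delta> j)) l)"

definition loading_evidence :: "nat \<Rightarrow> real" where
  "loading_evidence j = sqrt (\<delta> j) / sqrt (s_coef \<omega> \<delta> Z j)
     * (Gamma (real n / 2 + \<alpha> j / 2) / Gamma (\<alpha> j / 2))
     * (\<beta> j powr \<alpha> j / ((\<beta> j)\<^sup>2 + t_coef \<omega> \<delta> \<nu> X Z j) powr (real n / 2 + \<alpha> j / 2))"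

lemma loading_factor_nonneg: "j < p \<Longrightarrow> loading_factor j v l \<ge> 0"
  using \<alpha>[of j] unfolding loading_factor_def inv_gamma_density_def
  by (intro mult_nonneg_nonneg prod_nonneg divide_nonneg_nonneg) auto

lemma loading_evidence_nonneg:
  assumes "j < p"
  shows "loading_evidence j \<ge> 0"
proof -
  have "s_coef \<omega> \<delta> Z j \<ge> 0"
    unfolding s_coef_eq[OF assms] using \<delta>[OF assms] by (intro add_nonneg_nonneg sum_nonneg) auto
  then show ?thesis
    using \<alpha>[OF assms] \<delta>[OF assms] unfolding loading_evidence_def
    by (intro mult_nonneg_nonneg divide_nonneg_nonneg) (auto intro!: Gamma_real_nonneg)
qed

lemma nn_integral_loading_factor:
  assumes "j < p"
  shows "(\<integral>\<^sup>+v. (\<integral>\<^sup>+l. ennreal (loading_factor j v l) \<partial>lborel) \<partial>restrict_space lborel {0<..})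
     = ennreal (pi powr (- real n / 2) * loading_evidence j)"
  using nn_integral_normal_inverse_gamma[OF \<delta>[OF assms] \<alpha>[OF assms] \<beta>[OF assms],
      where n = n and z = "\<lambda>i. Z $$ (i, load_col j)" and x = "\<lambda>i. X $$ (i, j)" and \<nu> = "\<nu> j"] X
  by (simp add: loading_factor_def loading_evidence_def s_coef_eq[OF assms] a_coef_eq[OF assms] t_coef_def)

lemma borel_measurable_loading_factor:
  "(\<lambda>(v, l). loading_factor j v l) \<in> borel_measurable (borel \<Otimes>\<^sub>M borel)"
  unfolding loading_factor_def normal_density_def inv_gamma_density_def by measurable

lemma borel_measurable_loading_factor_compose:
  assumes "a \<in> borel_measurable M" "b \<in> borel_measurable M"
  shows "(\<lambda>x. loading_factor j (a x) (b x)) \<in> borel_measurable M"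
  using measurable_compose[OF measurable_Pair[OF assms] borel_measurable_loading_factor[of j]] by simp

abbreviation pos_lborel :: "real measure" where
  "pos_lborel \<equiv> restrict_space lborel {0<..}"

lemma measurable_pos_lborel: "(\<lambda>v::real. v) \<in> borel_measurable pos_lborel"
  by (rule measurable_restrict_space1) simp

text \<open>For fixed \<open>v\<close> each loading occurs in one factor only; once the loadings are
  integrated out, each \<open>v j\<close> does too. Both product integrals thus split into
  one-dimensional ones.\<close>

lemma nn_integral_loadings:
  "(\<integral>\<^sup>+v. (\<integral>\<^sup>+x. ennreal (\<Prod>j<p. loading_factor j (v j) (x (j, load_col j)))
       \<partial>(\<Pi>\<^sub>M e\<in>free_entries \<omega>. lborel)) \<partial>(\<Pi>\<^sub>M j\<in>{..<p}. pos_lborel))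
   = ennreal (\<Prod>j<p. pi powr (- real n / 2) * loading_evidence j)"
proof -
  interpret L: product_sigma_finite "\<lambda>_. lborel :: real measure" ..
  interpret P: product_sigma_finite "\<lambda>_. pos_lborel"
    by (intro product_sigma_finite.intro sigma_finite_measure_restrict_space sigma_finite_lborel) simp
  have inj: "inj_on (\<lambda>j. (j, load_col j)) {..<p}" by (rule inj_onI) simp
  have inner: "(\<integral>\<^sup>+x. ennreal (\<Prod>j<p. loading_factor j (v j) (x (j, load_col j))) \<partial>(\<Pi>\<^sub>M e\<in>free_entries \<omega>. lborel))
     = (\<Prod>j<p. \<integral>\<^sup>+l. ennreal (loading_factor j (v j) l) \<partial>lborel)" for v
  proof -
    have "(\<integral>\<^sup>+x. ennreal (\<Prod>j<p. loading_factor j (v j) (x (j, load_col j))) \<partial>(\<Pi>\<^sub>M e\<in>free_entries \<omega>. lborel))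
       = (\<integral>\<^sup>+x. (\<Prod>e\<in>free_entries \<omega>. ennreal (loading_factor (fst e) (v (fst e)) (x e))) \<partial>(\<Pi>\<^sub>M e\<in>free_entries \<omega>. lborel))"
      by (intro nn_integral_cong)
        (simp add: free_entries_\<omega> prod.reindex[OF inj], rule prod_ennreal[symmetric],
          simp add: loading_factor_nonneg)
    also have "\<dots> = (\<Prod>e\<in>free_entries \<omega>. \<integral>\<^sup>+l. ennreal (loading_factor (fst e) (v (fst e)) l) \<partial>lborel)"
      by (rule L.product_nn_integral_prod)
        (auto simp: free_entries_\<omega> intro!: measurable_compose[OF _ measurable_ennreal]
          borel_measurable_loading_factor_compose)
    also have "\<dots> = (\<Prod>j<p. \<integral>\<^sup>+l. ennreal (loading_factor j (v j) l) \<partial>lborel)"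
      by (simp add: free_entries_\<omega> prod.reindex[OF inj])
    finally show ?thesis .
  qed
  have "(\<integral>\<^sup>+v. (\<Prod>j<p. \<integral>\<^sup>+l. ennreal (loading_factor j (v j) l) \<partial>lborel) \<partial>(\<Pi>\<^sub>M j\<in>{..<p}. pos_lborel))
     = (\<Prod>j<p. \<integral>\<^sup>+v. (\<integral>\<^sup>+l. ennreal (loading_factor j v l) \<partial>lborel) \<partial>pos_lborel)"
  proof (rule P.product_nn_integral_prod)
    fix j
    have "(\<lambda>z. loading_factor j (fst z) (snd z)) \<in> borel_measurable (pos_lborel \<Otimes>\<^sub>M lborel)"
      by (intro borel_measurable_loading_factor_compose measurable_compose[OF measurable_fst measurable_pos_lborel])
        simp
    then show "(\<lambda>v. \<integral>\<^sup>+l. ennreal (loading_factor j v l) \<partial>lborel) \<in> borel_measurable pos_lborel"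
      by (intro lborel.borel_measurable_nn_integral) (simp add: split_beta')
  qed simp
  also have "\<dots> = (\<Prod>j<p. ennreal (pi powr (- real n / 2) * loading_evidence j))"
    by (intro prod.cong) (auto simp: nn_integral_loading_factor)
  also have "\<dots> = ennreal (\<Prod>j<p. pi powr (- real n / 2) * loading_evidence j)"
    by (intro prod_ennreal) (simp add: loading_evidence_nonneg)
  finally show ?thesis by (simp only: inner)
qed

section \<open>Factorisation of the integrand and assembly of the integral\<close>

lemma complete_likelihood_eq:
  assumes v: "\<forall>j<p. v j > 0"
  shows "complete_likelihood n p q X Z (fill_pattern \<omega> x) (mat_diag p v) (fill_pattern f y)
     = (\<Prod>j<p. \<Prod>i<n. normal_density (x (j, load_col j) * Z $$ (i, load_col j)) (sqrt (v j)) (X $$ (i, j))) *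
       ((1 / (2 * pi) powr (real q / 2)) ^ n *
        (\<Prod>h<q. exp (- (1/2) * (\<Sum>i<n. (Z $$ (i, h) - (\<Sum>l<q. fill_pattern f y $$ (h, l) * Z $$ (i, l)))\<^sup>2))))"
proof -
  let ?r = "\<lambda>i h. Z $$ (i, h) - (\<Sum>l<q. fill_pattern f y $$ (h, l) * Z $$ (i, l))"
  have B: "fill_pattern f y \<in> carrier_mat q q" using f(1) by (simp add: fill_pattern_def)
  have tri: "fill_pattern f y $$ (h, l) = 0" if "h < q" "l < q" "h \<le> l" for h l
    using f(1) f_tri[OF that] that by (simp add: fill_pattern_def)
  have 1: "mvn_density p (row X i) (fill_pattern \<omega> x *\<^sub>v row Z i) (mat_diag p v)
     = (\<Prod>j<p. normal_density (x (j, load_col j) * Z $$ (i, load_col j)) (sqrt (v j)) (X $$ (i, j)))"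
    if "i < n" for i
  proof -
    have "row X i \<in> carrier_vec p" "fill_pattern \<omega> x *\<^sub>v row Z i \<in> carrier_vec p"
      using that X Z \<omega>(1) by (auto simp: fill_pattern_def intro!: carrier_vecI)
    then have "mvn_density p (row X i) (fill_pattern \<omega> x *\<^sub>v row Z i) (mat_diag p v)
       = (\<Prod>j<p. normal_density ((fill_pattern \<omega> x *\<^sub>v row Z i) $ j) (sqrt (v j)) (row X i $ j))"
      by (rule mvn_density_diag) (use v in simp)
    also have "\<dots> = (\<Prod>j<p. normal_density (x (j, load_col j) * Z $$ (i, load_col j)) (sqrt (v j)) (X $$ (i, j)))"
      using that X by (intro prod.cong refl) (simp add: fill_pattern_\<omega>_mult del: index_mult_mat_vec)
    finally show ?thesis .
  qed
  have 2: "mvn_density q (row Z i) (0\<^sub>v q) (latent_cov q (fill_pattern f y))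
     = exp (- (1/2) * (\<Sum>h<q. (?r i h)\<^sup>2)) * (1 / (2 * pi) powr (real q / 2))" if "i < n" for i
  proof -
    have z: "row Z i \<in> carrier_vec q" using that Z by (auto intro!: carrier_vecI)
    have "(\<Sum>h<q. (row Z i $ h - (\<Sum>l<q. fill_pattern f y $$ (h, l) * row Z i $ l))\<^sup>2) = (\<Sum>h<q. (?r i h)\<^sup>2)"
      using that Z by simp
    with mvn_density_latent_cov[OF B tri z] show ?thesis by simp
  qed
  \<comment> \<open>Interchanging the sums over observations and over rows in the exponent turns the
    latent likelihood into a product over the rows of B.\<close>
  have "(\<Prod>i<n. exp (- (1/2) * (\<Sum>h<q. (?r i h)\<^sup>2))) = exp (\<Sum>i<n. \<Sum>h<q. - (1/2) * (?r i h)\<^sup>2)"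
    by (simp only: exp_sum[OF finite_lessThan] sum_distrib_left)
  also have "\<dots> = exp (\<Sum>h<q. \<Sum>i<n. - (1/2) * (?r i h)\<^sup>2)"
    by (subst sum.swap) simp
  also have "\<dots> = (\<Prod>h<q. exp (- (1/2) * (\<Sum>i<n. (?r i h)\<^sup>2)))"
    by (simp only: exp_sum[OF finite_lessThan] sum_distrib_left)
  finally have 3: "(\<Prod>i<n. exp (- (1/2) * (\<Sum>h<q. (?r i h)\<^sup>2))) = (\<Prod>h<q. exp (- (1/2) * (\<Sum>i<n. (?r i h)\<^sup>2)))" .
  have "complete_likelihood n p q X Z (fill_pattern \<omega> x) (mat_diag p v) (fill_pattern f y)
     = (\<Prod>i<n. (\<Prod>j<p. normal_density (x (j, load_col j) * Z $$ (i, load_col j)) (sqrt (v j)) (X $$ (i, j))) *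
           (exp (- (1/2) * (\<Sum>h<q. (?r i h)\<^sup>2)) * (1 / (2 * pi) powr (real q / 2))))"
    unfolding complete_likelihood_def by (intro prod.cong refl) (simp only: lessThan_iff 1 2)
  also have "\<dots> = (\<Prod>i<n. \<Prod>j<p. normal_density (x (j, load_col j) * Z $$ (i, load_col j)) (sqrt (v j)) (X $$ (i, j))) *
           ((\<Prod>i<n. exp (- (1/2) * (\<Sum>h<q. (?r i h)\<^sup>2))) * (1 / (2 * pi) powr (real q / 2)) ^ n)"
    by (simp only: prod.distrib prod_constant card_lessThan)
  finally show ?thesis
    unfolding 3 by (subst prod.swap) (simp only: mult.commute)
qed

text \<open>The exponent \<open>\<omega> $$ (j, h)\<close> acts as a selector: a factor with
  exponent 0 is 1, so only the column \<open>load_col j\<close> survives.\<close>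

lemma prior_loadings_eq:
  "prior_loadings p q \<omega> \<alpha> \<beta> \<delta> \<nu> (fill_pattern \<omega> x) (mat_diag p v)
     = (\<Prod>j<p. inv_gamma_density (v j) (\<alpha> j / 2) ((\<beta> j)\<^sup>2 / 2) *
          normal_density (\<nu> j) (sqrt (v j / \<delta> j)) (x (j, load_col j)))"
proof -
  have "(\<Prod>h<q. normal_density (\<nu> j) (sqrt (v j / \<delta> j)) (fill_pattern \<omega> x $$ (j, h)) ^ (\<omega> $$ (j, h)))
     = normal_density (\<nu> j) (sqrt (v j / \<delta> j)) (x (j, load_col j))" if "j < p" for j
  proof -
    have "(\<Prod>h<q. normal_density (\<nu> j) (sqrt (v j / \<delta> j)) (fill_pattern \<omega> x $$ (j, h)) ^ (\<omega> $$ (j, h)))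
       = (\<Prod>h<q. if h = load_col j then normal_density (\<nu> j) (sqrt (v j / \<delta> j)) (x (j, load_col j)) else 1)"
      using that by (intro prod.cong) (auto simp: fill_pattern_\<omega> \<omega>_entry)
    then show ?thesis using load_col(1)[OF that] by simp
  qed
  then show ?thesis
    unfolding prior_loadings_def by (intro prod.cong) (auto simp: mat_diag_def)
qed

text \<open>Rows without parents are padded with the factor 1, so that prior and likelihood are
  products over the same range and merge row by row.\<close>

lemma prior_coeffs_eq:
  "prior_coeffs q f \<mu> \<kappa> (fill_pattern f y)
     = (\<Prod>h<q. if indeg f h > 0 then mvn_density (indeg f h) (coeff_vec h y) (\<mu> h) (inv_mat (\<kappa> h)) else 1)"
  unfolding prior_coeffs_def
  by (rule prod.mono_neutral_cong_left) (auto simp: subvector_fill_pattern)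

text \<open>Positivity of the variances holds on the whole space of \<open>param_measure\<close>, so
  this identity applies at every point of it and not just almost everywhere.\<close>

lemma integrand_eq:
  assumes "\<forall>j<p. v j > 0"
  shows "complete_likelihood n p q X Z (fill_pattern \<omega> x) (mat_diag p v) (fill_pattern f y) *
      (prior_loadings p q \<omega> \<alpha> \<beta> \<delta> \<nu> (fill_pattern \<omega> x) (mat_diag p v) * prior_coeffs q f \<mu> \<kappa> (fill_pattern f y))
    = (\<Prod>j<p. loading_factor j (v j) (x (j, load_col j))) *
      ((1 / (2 * pi) powr (real q / 2)) ^ n * (\<Prod>h<q. row_factor h y))"
  unfolding complete_likelihood_eq[OF assms] prior_loadings_eq prior_coeffs_eq loading_factor_def row_factor_def
    prod.distrib by (simp only: mult_ac)

text \<open>For a nonnegative measurable integrand the Bochner integral is \<open>enn2real\<close>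
  of the nonnegative one. The latter comes out as a nonnegative real number, so finiteness is a
  result of the computation and not a premise.\<close>

lemma integrated_likelihood_eq:
  "integrated_likelihood n p q f \<omega> \<alpha> \<beta> \<delta> \<nu> \<mu> \<kappa> X Z =
     (\<Prod>j<p. pi powr (- real n / 2) * loading_evidence j) *
     ((1 / (2 * pi) powr (real q / 2)) ^ n * (\<Prod>h<q. row_evidence h))"
proof -
  let ?K = "(1 / (2 * pi) powr (real q / 2)) ^ n"
  let ?G = "\<lambda>v x. \<Prod>j<p. loading_factor j (v j) (x (j, load_col j))"
  let ?H = "\<lambda>y. ?K * (\<Prod>h<q. row_factor h y)"
  let ?M1 = "\<Pi>\<^sub>M j\<in>{..<p}. pos_lborel" and ?M2 = "\<Pi>\<^sub>M e\<in>free_entries \<omega>. (lborel :: real measure)"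
    and ?M3 = "\<Pi>\<^sub>M e\<in>free_entries f. (lborel :: real measure)"
  interpret L: product_sigma_finite "\<lambda>_. lborel :: real measure" ..
  have fin: "finite (free_entries \<omega>)" "finite (free_entries f)"
    unfolding free_entries_\<omega> free_entries_eq by (auto simp: row_entries_def)
  have G: "(\<lambda>(v, x). ?G v x) \<in> borel_measurable (?M1 \<Otimes>\<^sub>M ?M2)"
  proof -
    have "(\<lambda>z. loading_factor j (fst z j) (snd z (j, load_col j))) \<in> borel_measurable (?M1 \<Otimes>\<^sub>M ?M2)"
      if "j < p" for j
    proof (rule borel_measurable_loading_factor_compose)
      have "(\<lambda>v. v j) \<in> ?M1 \<rightarrow>\<^sub>M pos_lborel"
        using that by (intro measurable_component_singleton) simp
      from measurable_compose[OF this measurable_pos_lborel] show "(\<lambda>z. fst z j) \<in> borel_measurable (?M1 \<Otimes>\<^sub>M ?M2)"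
        by (rule measurable_compose[OF measurable_fst])
      have "(\<lambda>x. x (j, load_col j)) \<in> borel_measurable ?M2"
        using measurable_component_singleton[of "(j, load_col j)" "free_entries \<omega>" "\<lambda>_. lborel :: real measure"]
          that by (auto simp: free_entries_\<omega>)
      then show "(\<lambda>z. snd z (j, load_col j)) \<in> borel_measurable (?M1 \<Otimes>\<^sub>M ?M2)"
        by (rule measurable_compose[OF measurable_snd])
    qed
    then show ?thesis unfolding split_beta' by (intro borel_measurable_prod) auto
  qed
  have H: "?H \<in> borel_measurable ?M3"
    by (intro borel_measurable_times borel_measurable_const borel_measurable_prod borel_measurable_row_factor)
      (auto simp: free_entries_eq)
  have nonneg: "?G v x \<ge> 0" "?H y \<ge> 0" for v x y
    by (auto intro!: prod_nonneg mult_nonneg_nonneg loading_factor_nonneg row_factor_nonneg)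
  have GH: "(\<lambda>(v, x, y). ?G v x * ?H y) \<in> borel_measurable (?M1 \<Otimes>\<^sub>M ?M2 \<Otimes>\<^sub>M ?M3)"
  proof -
    have "(\<lambda>z. (fst z, fst (snd z))) \<in> ?M1 \<Otimes>\<^sub>M ?M2 \<Otimes>\<^sub>M ?M3 \<rightarrow>\<^sub>M ?M1 \<Otimes>\<^sub>M ?M2" by measurable
    from measurable_compose[OF this G] have "(\<lambda>z. ?G (fst z) (fst (snd z))) \<in> borel_measurable (?M1 \<Otimes>\<^sub>M ?M2 \<Otimes>\<^sub>M ?M3)"
      by simp
    moreover have "(\<lambda>z. snd (snd z)) \<in> ?M1 \<Otimes>\<^sub>M ?M2 \<Otimes>\<^sub>M ?M3 \<rightarrow>\<^sub>M ?M3" by measurable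
    from measurable_compose[OF this H] have "(\<lambda>z. ?H (snd (snd z))) \<in> borel_measurable (?M1 \<Otimes>\<^sub>M ?M2 \<Otimes>\<^sub>M ?M3)" .
    ultimately show ?thesis unfolding split_beta' by (rule borel_measurable_times)
  qed
  have "integrated_likelihood n p q f \<omega> \<alpha> \<beta> \<delta> \<nu> \<mu> \<kappa> X Z
     = (\<integral>(v, x, y). ?G v x * ?H y \<partial>(?M1 \<Otimes>\<^sub>M ?M2 \<Otimes>\<^sub>M ?M3))"
    unfolding integrated_likelihood_def param_measure_def Let_def
  proof (intro Bochner_Integration.integral_cong refl, clarify)
    fix v x y assume "(v, x, y) \<in> space (?M1 \<Otimes>\<^sub>M ?M2 \<Otimes>\<^sub>M ?M3)"
    then have "\<forall>j<p. v j > 0"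
      by (auto simp: space_pair_measure space_PiM space_restrict_space PiE_iff)
    then show "complete_likelihood n p q X Z (fill_pattern \<omega> x) (mat_diag p v) (fill_pattern f y) *
      (prior_loadings p q \<omega> \<alpha> \<beta> \<delta> \<nu> (fill_pattern \<omega> x) (mat_diag p v) * prior_coeffs q f \<mu> \<kappa> (fill_pattern f y))
      = ?G v x * ?H y" by (rule integrand_eq)
  qed
  also have "\<dots> = enn2real (\<integral>\<^sup>+z. ennreal ((\<lambda>(v, x, y). ?G v x * ?H y) z) \<partial>(?M1 \<Otimes>\<^sub>M ?M2 \<Otimes>\<^sub>M ?M3))"
  proof (rule integral_eq_nn_integral[OF GH], rule AE_I2)
    show "0 \<le> (case z of (v, x, y) \<Rightarrow> ?G v x * ?H y)" for z
      by (cases z) (simp only: prod.case mult_nonneg_nonneg nonneg)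
  qed
  also have "(\<integral>\<^sup>+z. ennreal ((\<lambda>(v, x, y). ?G v x * ?H y) z) \<partial>(?M1 \<Otimes>\<^sub>M ?M2 \<Otimes>\<^sub>M ?M3))
     = (\<integral>\<^sup>+(v, x, y). ennreal (?G v x) * ennreal (?H y) \<partial>(?M1 \<Otimes>\<^sub>M ?M2 \<Otimes>\<^sub>M ?M3))"
  proof (rule nn_integral_cong)
    show "ennreal ((\<lambda>(v, x, y). ?G v x * ?H y) z) = (case z of (v, x, y) \<Rightarrow> ennreal (?G v x) * ennreal (?H y))" for z
      by (cases z) (simp only: prod.case ennreal_mult'[OF nonneg(1)])
  qed
  also have "\<dots> = (\<integral>\<^sup>+v. \<integral>\<^sup>+x. ennreal (?G v x) \<partial>?M2 \<partial>?M1) * (\<integral>\<^sup>+y. ennreal (?H y) \<partial>?M3)"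
  proof (rule nn_integral_triple_product)
    show "sigma_finite_measure ?M2" "sigma_finite_measure ?M3" by (rule L.sigma_finite[OF fin(1)], rule L.sigma_finite[OF fin(2)])
    show "(\<lambda>(v, x). ennreal (?G v x)) \<in> borel_measurable (?M1 \<Otimes>\<^sub>M ?M2)"
      using measurable_compose[OF G measurable_ennreal] by (simp add: split_beta')
    show "(\<lambda>y. ennreal (?H y)) \<in> borel_measurable ?M3"
      by (rule measurable_compose[OF H measurable_ennreal])
  qed
  also have "(\<integral>\<^sup>+y. ennreal (?H y) \<partial>?M3) = ennreal (?K * (\<Prod>h<q. row_evidence h))"
  proof -
    have K: "?K \<ge> 0" by simp
    have m: "(\<lambda>y. \<Prod>h<q. row_factor h y) \<in> borel_measurable ?M3"
      by (intro borel_measurable_prod borel_measurable_row_factor) (auto simp: free_entries_eq)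
    have "(\<integral>\<^sup>+y. ennreal (?H y) \<partial>?M3) = (\<integral>\<^sup>+y. ennreal ?K * ennreal (\<Prod>h<q. row_factor h y) \<partial>?M3)"
      by (simp only: ennreal_mult'[OF K])
    also have "\<dots> = ennreal ?K * (\<integral>\<^sup>+y. ennreal (\<Prod>h<q. row_factor h y) \<partial>?M3)"
      by (rule nn_integral_cmult) (rule measurable_compose[OF m measurable_ennreal])
    finally show ?thesis by (simp only: nn_integral_rows ennreal_mult'[OF K])
  qed
  also have "(\<integral>\<^sup>+v. \<integral>\<^sup>+x. ennreal (?G v x) \<partial>?M2 \<partial>?M1) * \<dots>
     = ennreal ((\<Prod>j<p. pi powr (- real n / 2) * loading_evidence j) * (?K * (\<Prod>h<q. row_evidence h)))"
    unfolding nn_integral_loadings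
    by (intro ennreal_mult'[symmetric] prod_nonneg) (auto intro!: mult_nonneg_nonneg loading_evidence_nonneg)
  also have "enn2real \<dots> = (\<Prod>j<p. pi powr (- real n / 2) * loading_evidence j) * (?K * (\<Prod>h<q. row_evidence h))"
    by (intro enn2real_ennreal mult_nonneg_nonneg prod_nonneg)
      (auto intro!: loading_evidence_nonneg row_evidence_nonneg)
  finally show ?thesis .
qed

text \<open>Each column of \<open>X\<close> contributes \<open>pi powr (- n / 2)\<close>, its power
  of 2 having cancelled already, while each latent observation keeps the full
  \<open>(2 * pi) powr (- q / 2)\<close>. Hence the exponent of 2 involves \<open>q\<close> alone
  and that of \<open>pi\<close> both \<open>p\<close> and \<open>q\<close>.\<close>

lemma constant_eq:
  "(pi powr (- real n / 2)) ^ p * (1 / (2 * pi) powr (real q / 2)) ^ n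
     = 1 / (pi powr (real ((p + q) * n) / 2) * 2 powr (real (q * n) / 2))"
proof -
  have "(pi powr (- real n / 2)) ^ p = pi powr (- real (p * n) / 2)"
    by (simp add: powr_power mult.commute)
  moreover have "(1 / (2 * pi) powr (real q / 2)) ^ n = (2 * pi) powr (- real (q * n) / 2)"
    by (simp add: powr_minus_divide[symmetric] powr_power mult.commute[of "real q"])
  moreover have "\<dots> = 2 powr (- real (q * n) / 2) * pi powr (- real (q * n) / 2)"
    by (simp add: powr_mult)
  moreover have "pi powr (- real (p * n) / 2) * pi powr (- real (q * n) / 2) = pi powr (- real ((p + q) * n) / 2)"
    by (simp add: powr_add[symmetric] field_simps)
  ultimately have "(pi powr (- real n / 2)) ^ p * (1 / (2 * pi) powr (real q / 2)) ^ n
     = pi powr (- real ((p + q) * n) / 2) * 2 powr (- real (q * n) / 2)"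
    by (simp add: mult_ac)
  then show ?thesis by (simp add: powr_minus_divide)
qed

end

theorem proposition1:
  fixes n p q :: nat
    and f \<omega> :: "nat mat"
    and \<alpha> \<beta> \<delta> \<nu> :: "nat \<Rightarrow> real"
    and \<mu> :: "nat \<Rightarrow> real vec" and \<kappa> :: "nat \<Rightarrow> real mat"
    and X Z :: "real mat"
  assumes "n \<ge> 1" and "p \<ge> 1" and "q \<ge> 1"
    and "f \<in> carrier_mat q q" and "elements_mat f \<subseteq> {0, 1}"
    and "\<And>h l. h < q \<Longrightarrow> l < q \<Longrightarrow> h \<le> l \<Longrightarrow> f $$ (h, l) = 0"
    and "\<omega> \<in> carrier_mat p q" and "elements_mat \<omega> \<subseteq> {0, 1}"
    and "\<And>j. j < p \<Longrightarrow> \<exists>!h. h < q \<and> \<omega> $$ (j, h) = 1"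
    and "\<And>j. j < p \<Longrightarrow> \<alpha> j > 0" and "\<And>j. j < p \<Longrightarrow> \<beta> j > 0" and "\<And>j. j < p \<Longrightarrow> \<delta> j > 0"
    and "\<And>h. h < q \<Longrightarrow> indeg f h > 0 \<Longrightarrow> \<mu> h \<in> carrier_vec (indeg f h)"
    and "\<And>h. h < q \<Longrightarrow> indeg f h > 0 \<Longrightarrow> sym_pos_def_mat (indeg f h) (\<kappa> h)"
    and "X \<in> carrier_mat n p" and "Z \<in> carrier_mat n q"
  shows "integrated_likelihood n p q f \<omega> \<alpha> \<beta> \<delta> \<nu> \<mu> \<kappa> X Z =
    1 / (pi powr (real ((p + q) * n) / 2) * 2 powr (real (q * n) / 2))
    * (\<Prod>h<q. exp (- (1 / 2) * (\<Sum>i<n. (Z $$ (i, h))\<^sup>2)) *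
        (if indeg f h > 0
         then sqrt (det (\<kappa> h)) / sqrt (det (S_tilde f \<kappa> Z h)) * exp (- t_tilde f \<mu> \<kappa> Z h / 2)
         else 1))
    * (\<Prod>j<p. sqrt (\<delta> j) / sqrt (s_coef \<omega> \<delta> Z j)
        * (Gamma (real n / 2 + \<alpha> j / 2) / Gamma (\<alpha> j / 2))
        * (\<beta> j powr \<alpha> j / ((\<beta> j)\<^sup>2 + t_coef \<omega> \<delta> \<nu> X Z j) powr (real n / 2 + \<alpha> j / 2)))"
proof -
  interpret gaussian_sem n p q f \<omega> \<alpha> \<beta> \<delta> \<nu> \<mu> \<kappa> X Z
    by (rule gaussian_sem.intro) (fact assms)+
  have "integrated_likelihood n p q f \<omega> \<alpha> \<beta> \<delta> \<nu> \<mu> \<kappa> X Z =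
     ((pi powr (- real n / 2)) ^ p * (1 / (2 * pi) powr (real q / 2)) ^ n) *
     (\<Prod>h<q. row_evidence h) * (\<Prod>j<p. loading_evidence j)"
    unfolding integrated_likelihood_eq prod.distrib by (simp add: mult_ac)
  then show ?thesis
    unfolding constant_eq row_evidence_def loading_evidence_def .
qed

end
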